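(* Every epicomplete $MV$-algebra is divisible.
   Context: An $MV$-algebra $(M;\oplus,',0,1)$ is meant in the usual sense: $(M;\oplus,0)$ is a commutative monoid, $1=0'$, $x''=x$, $x\oplus 1=1$, and $x\oplus(x\oplus y')'=y\oplus(y\oplus x')'$. $\mathcal{MV}$ is the category of $MV$-algebras and $MV$-homomorphisms. For an integer $n\ge 0$, $0.x=0$, $1.x=x$ and $n.x=(n-1).x\oplus x$ for $n\ge 2$. An epimorphism is a categorical epimorphism in $\mathcal{MV}$: an $MV$-homomorphism $f:M_1\to M_2$ such that for every $MV$-algebra $M_3$ and all $MV$-homomorphisms $\alpha,\beta:M_2\to M_3$, $\alpha\circ f=\beta\circ f$ implies $\alpha=\beta$. An $MV$-algebra $M$ is epicomplete if every epimorphism $\alpha:M\to A$ in $\mathcal{MV}$ (for every $MV$-algebra $A$) is surjective. An $MV$-algebra $M$ is divisible if for all $a\in M$ and all integers $n\ge 1$ there exists $x\in M$ such that $n.x=a$ and $a'\oplus((n-1).x)=x'$. *)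

theory Defs
  imports "HOL-Algebra.Group"
begin

section \<open>MV-algebras\<close>

record 'a mv = "'a partial_object" +
  oplus :: "'a \<Rightarrow> 'a \<Rightarrow> 'a" (infixl "\<oplus>\<index>" 65)
  neg :: "'a \<Rightarrow> 'a" ("\<sim>\<index> _" [81] 80)
  bot0 :: 'a ("\<^bold>0\<index>")
  top1 :: 'a ("\<^bold>1\<index>")

locale mv_algebra =
  fixes M :: "'a mv" (structure)
  assumes comm_monoid_oplus:
      "comm_monoid \<lparr>carrier = carrier M, monoid.mult = (\<oplus>), one = \<^bold>0\<rparr>"
    and neg_closed: "x \<in> carrier M \<Longrightarrow> \<sim> x \<in> carrier M"
    and top1_eq: "\<^bold>1 = \<sim> \<^bold>0"
    and neg_neg: "x \<in> carrier M \<Longrightarrow> \<sim> (\<sim> x) = x"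
    and oplus_top1: "x \<in> carrier M \<Longrightarrow> x \<oplus> \<^bold>1 = \<^bold>1"
    and lukasiewicz: "\<lbrakk>x \<in> carrier M; y \<in> carrier M\<rbrakk> \<Longrightarrow>
      x \<oplus> \<sim> (x \<oplus> \<sim> y) = y \<oplus> \<sim> (y \<oplus> \<sim> x)"

definition mv_hom :: "'a mv \<Rightarrow> 'b mv \<Rightarrow> ('a \<Rightarrow> 'b) set" where
  "mv_hom M N = {h \<in> carrier M \<rightarrow> carrier N.
     (\<forall>x\<in>carrier M. \<forall>y\<in>carrier M. h (x \<oplus>\<^bsub>M\<^esub> y) = h x \<oplus>\<^bsub>N\<^esub> h y) \<and>
     (\<forall>x\<in>carrier M. h (\<sim>\<^bsub>M\<^esub> x) = \<sim>\<^bsub>N\<^esub> h x) \<and>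
     h \<^bold>0\<^bsub>M\<^esub> = \<^bold>0\<^bsub>N\<^esub> \<and> h \<^bold>1\<^bsub>M\<^esub> = \<^bold>1\<^bsub>N\<^esub>}"

fun multiple :: "'a mv \<Rightarrow> nat \<Rightarrow> 'a \<Rightarrow> 'a" where
  "multiple M 0 x = \<^bold>0\<^bsub>M\<^esub>"
| "multiple M (Suc 0) x = x"
| "multiple M (Suc (Suc n)) x = multiple M (Suc n) x \<oplus>\<^bsub>M\<^esub> x"

definition mv_divisible :: "'a mv \<Rightarrow> bool" where
  "mv_divisible M \<longleftrightarrow> (\<forall>a\<in>carrier M. \<forall>n\<ge>1. \<exists>x\<in>carrier M.
     multiple M n x = a \<and> \<sim>\<^bsub>M\<^esub> a \<oplus>\<^bsub>M\<^esub> multiple M (n - 1) x = \<sim>\<^bsub>M\<^esub> x)"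


section \<open>Epimorphisms and epicompleteness\<close>

text \<open>
  Homomorphisms matter only on the carrier, so equality of two of them is equality there.
  HOL cannot quantify over all types inside a definition, so the test algebras in
  the definition of an epimorphism with codomain on \<open>'b\<close> live on \<open>'b + nat\<close>, and the codomains
  in the definition of epicompleteness of an algebra on \<open>'a\<close> live on \<open>'a + nat\<close>. These types are
  large enough for neither notion to depend on the choice: the theorems
  \<open>mv_epi_cancel\<close> and \<open>epicomplete_surj\<close> below give the defining properties for
  algebras on arbitrary types.
\<close>

definition mv_epi :: "'a mv \<Rightarrow> 'b mv \<Rightarrow> ('a \<Rightarrow> 'b) \<Rightarrow> bool" where
  "mv_epi M A f \<longleftrightarrow> f \<in> mv_hom M A \<and>
     (\<forall>N :: ('b + nat) mv. mv_algebra N \<longrightarrow>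
        (\<forall>\<alpha>\<in>mv_hom A N. \<forall>\<beta>\<in>mv_hom A N.
           (\<forall>x\<in>carrier M. \<alpha> (f x) = \<beta> (f x)) \<longrightarrow> (\<forall>y\<in>carrier A. \<alpha> y = \<beta> y)))"

definition epicomplete :: "'a mv \<Rightarrow> bool" where
  "epicomplete M \<longleftrightarrow>
     (\<forall>A :: ('a + nat) mv. mv_algebra A \<longrightarrow>
        (\<forall>f. mv_epi M A f \<longrightarrow> f ` carrier M = carrier A))"


section \<open>Independence of the chosen types\<close>

lemma (in mv_algebra) mv_simps:
  shows "x \<in> carrier M \<Longrightarrow> y \<in> carrier M \<Longrightarrow> x \<oplus> y \<in> carrier M"
    and "\<^bold>0 \<in> carrier M" and "\<^bold>1 \<in> carrier M"
    and "\<lbrakk>x \<in> carrier M; y \<in> carrier M; z \<in> carrier M\<rbrakk> \<Longrightarrow> x \<oplus> y \<oplus> z = x \<oplus> (y \<oplus> z)"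
    and "\<lbrakk>x \<in> carrier M; y \<in> carrier M\<rbrakk> \<Longrightarrow> x \<oplus> y = y \<oplus> x"
    and "x \<in> carrier M \<Longrightarrow> \<^bold>0 \<oplus> x = x"
proof -
  interpret c: comm_monoid "\<lparr>carrier = carrier M, monoid.mult = (\<oplus>), one = \<^bold>0\<rparr>"
    by (rule comm_monoid_oplus)
  show "x \<in> carrier M \<Longrightarrow> y \<in> carrier M \<Longrightarrow> x \<oplus> y \<in> carrier M"
    using c.m_closed by simp
  show "\<^bold>0 \<in> carrier M" using c.one_closed by simp
  then show "\<^bold>1 \<in> carrier M" using top1_eq neg_closed by simp
  show "\<lbrakk>x \<in> carrier M; y \<in> carrier M; z \<in> carrier M\<rbrakk> \<Longrightarrow> x \<oplus> y \<oplus> z = x \<oplus> (y \<oplus> z)"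
    using c.m_assoc by simp
  show "\<lbrakk>x \<in> carrier M; y \<in> carrier M\<rbrakk> \<Longrightarrow> x \<oplus> y = y \<oplus> x"
    using c.m_comm by simp
  show "x \<in> carrier M \<Longrightarrow> \<^bold>0 \<oplus> x = x" using c.l_one by simp
qed

lemma mv_algebraI:
  assumes "\<And>x y. x \<in> carrier M \<Longrightarrow> y \<in> carrier M \<Longrightarrow> oplus M x y \<in> carrier M"
    and "bot0 M \<in> carrier M"
    and "\<And>x y z. \<lbrakk>x \<in> carrier M; y \<in> carrier M; z \<in> carrier M\<rbrakk> \<Longrightarrow>
      oplus M (oplus M x y) z = oplus M x (oplus M y z)"
    and "\<And>x y. \<lbrakk>x \<in> carrier M; y \<in> carrier M\<rbrakk> \<Longrightarrow> oplus M x y = oplus M y x"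
    and "\<And>x. x \<in> carrier M \<Longrightarrow> oplus M (bot0 M) x = x"
    and "\<And>x. x \<in> carrier M \<Longrightarrow> neg M x \<in> carrier M"
    and "top1 M = neg M (bot0 M)"
    and "\<And>x. x \<in> carrier M \<Longrightarrow> neg M (neg M x) = x"
    and "\<And>x. x \<in> carrier M \<Longrightarrow> oplus M x (top1 M) = top1 M"
    and "\<And>x y. \<lbrakk>x \<in> carrier M; y \<in> carrier M\<rbrakk> \<Longrightarrow>
      oplus M x (neg M (oplus M x (neg M y))) = oplus M y (neg M (oplus M y (neg M x)))"
  shows "mv_algebra M"
proof (rule mv_algebra.intro)
  show "comm_monoid \<lparr>carrier = carrier M, monoid.mult = oplus M, one = bot0 M\<rparr>"
    by (rule comm_monoidI) (use assms(1-5) in simp_all)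
qed (use assms(6-10) in auto)

definition mv_transport :: "('a \<Rightarrow> 'b) \<Rightarrow> 'a set \<Rightarrow> 'a mv \<Rightarrow> 'b mv" where
  "mv_transport i Y M = \<lparr>carrier = i ` Y,
     oplus = (\<lambda>p q. i (the_inv_into Y i p \<oplus>\<^bsub>M\<^esub> the_inv_into Y i q)),
     neg = (\<lambda>p. i (\<sim>\<^bsub>M\<^esub> the_inv_into Y i p)),
     bot0 = i \<^bold>0\<^bsub>M\<^esub>, top1 = i \<^bold>1\<^bsub>M\<^esub>\<rparr>"

definition mv_closed :: "'a mv \<Rightarrow> 'a set \<Rightarrow> bool" where
  "mv_closed M Y \<longleftrightarrow> Y \<subseteq> carrier M \<and> \<^bold>0\<^bsub>M\<^esub> \<in> Y \<and> \<^bold>1\<^bsub>M\<^esub> \<in> Y \<and>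
     (\<forall>x\<in>Y. \<sim>\<^bsub>M\<^esub> x \<in> Y) \<and> (\<forall>x\<in>Y. \<forall>y\<in>Y. x \<oplus>\<^bsub>M\<^esub> y \<in> Y)"

lemma mv_transport:
  assumes "mv_algebra M" "mv_closed M Y" "inj_on i Y"
  shows "mv_algebra (mv_transport i Y M)"
proof -
  interpret mv_algebra M by fact
  have Y: "Y \<subseteq> carrier M" "bot0 M \<in> Y" "top1 M \<in> Y" "\<And>x. x \<in> Y \<Longrightarrow> neg M x \<in> Y"
    "\<And>x y. x \<in> Y \<Longrightarrow> y \<in> Y \<Longrightarrow> oplus M x y \<in> Y"
    using assms(2) by (auto simp: mv_closed_def)
  have inv: "the_inv_into Y i (i x) = x" if "x \<in> Y" for x
    using that assms(3) by (simp add: the_inv_into_f_f)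
  have c: "x \<in> carrier M" if "x \<in> Y" for x using that Y(1) by auto
  show ?thesis
    apply (rule mv_algebraI)
             apply (auto simp: mv_transport_def inv Y top1_eq[symmetric] c mv_simps(4,6)
        neg_neg oplus_top1)
     apply (rule arg_cong[of _ _ i], rule mv_simps(5); simp add: c)
    apply (rule arg_cong[of _ _ i], rule lukasiewicz; simp add: c)
    done
qed

lemma mv_transport_hom:
  assumes "mv_closed M Y" "inj_on i Y" "h \<in> mv_hom L M" "h ` carrier L \<subseteq> Y"
  shows "(\<lambda>x. i (h x)) \<in> mv_hom L (mv_transport i Y M)"
proof -
  have inv: "the_inv_into Y i (i x) = x" if "x \<in> Y" for x
    using that assms(2) by (simp add: the_inv_into_f_f)
  have "h x \<in> Y" if "x \<in> carrier L" for x using that assms(4) by auto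
  then show ?thesis using assms(3) by (auto simp: mv_hom_def mv_transport_def inv)
qed

unbundle cardinal_syntax

lemma card_of_Un_le:
  assumes "infinite u" "|A| \<le>o |u|" "|B| \<le>o |u|"
  shows "|A \<union> B| \<le>o |u|"
  by (rule card_of_Un_ordLeq_infinite_Field)
    (use assms in \<open>simp_all add: Field_card_of card_of_card_order_on\<close>)

lemma small_closure:
  fixes g :: "'c \<Rightarrow> 'c \<Rightarrow> 'c set" and u :: "'u set"
  assumes u: "infinite u" and X: "|X| \<le>o |u|" "X \<subseteq> C"
    and g: "\<And>x y. x \<in> C \<Longrightarrow> y \<in> C \<Longrightarrow> finite (g x y) \<and> g x y \<subseteq> C"
  shows "\<exists>Y. X \<subseteq> Y \<and> Y \<subseteq> C \<and> |Y| \<le>o |u| \<and> (\<forall>x\<in>Y. \<forall>y\<in>Y. g x y \<subseteq> Y)"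
proof -
  define S where "S = rec_nat X (\<lambda>_ Z. Z \<union> (\<Union>p\<in>Z \<times> Z. g (fst p) (snd p)))"
  have S0: "S 0 = X" and SS: "\<And>n. S (Suc n) = S n \<union> (\<Union>p\<in>S n \<times> S n. g (fst p) (snd p))"
    by (simp_all add: S_def)
  have S: "S n \<subseteq> C \<and> |S n| \<le>o |u|" for n
  proof (induction n)
    case 0 then show ?case using X S0 by simp
  next
    case (Suc n)
    have 1: "|S n \<times> S n| \<le>o |u|"
      by (rule card_of_Sigma_ordLeq_infinite[OF u]) (use Suc in auto)
    have 2: "|g (fst p) (snd p)| \<le>o |u|" if "p \<in> S n \<times> S n" for p
    proof -
      have "finite (g (fst p) (snd p))" using that Suc g by (cases p) auto
      then show ?thesis using u
        by (intro ordLess_imp_ordLeq finite_ordLess_infinite[OF card_of_Well_order card_of_Well_order])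
          (simp_all add: Field_card_of)
    qed
    have "|\<Union>p\<in>S n \<times> S n. g (fst p) (snd p)| \<le>o |u|"
      by (rule card_of_UNION_ordLeq_infinite[OF u 1]) (use 2 in blast)
    then have "|S (Suc n)| \<le>o |u|"
      unfolding SS using Suc u card_of_Un_le by blast
    moreover have "S (Suc n) \<subseteq> C" unfolding SS using Suc g by fastforce
    ultimately show ?case by simp
  qed
  have mono: "S m \<subseteq> S n" if "m \<le> n" for m n
    using that by (rule lift_Suc_mono_le[rotated]) (auto simp: SS)
  have "|UNIV :: nat set| \<le>o |u|" using u infinite_iff_card_of_nat by blast
  then have "|\<Union>n. S n| \<le>o |u|"
    by (rule card_of_UNION_ordLeq_infinite[OF u]) (use S in blast)
  moreover have "g x y \<subseteq> (\<Union>n. S n)" if xy: "x \<in> (\<Union>n. S n)" "y \<in> (\<Union>n. S n)" for x y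
  proof -
    obtain m n where "x \<in> S m" "y \<in> S n" using xy by blast
    then have "x \<in> S (max m n)" "y \<in> S (max m n)" using mono by (meson max.cobounded1 max.cobounded2 subsetD)+
    then have "g x y \<subseteq> S (Suc (max m n))" unfolding SS by fastforce
    then show ?thesis by blast
  qed
  ultimately show ?thesis using S S0 by (intro exI[of _ "\<Union>n. S n"]) blast
qed

lemma infinite_plus_nat: "infinite (UNIV :: ('a + nat) set)"
  by simp

lemma card_le_plus_nat:
  fixes X :: "'a set" and f :: "'a \<Rightarrow> 'c"
  shows "|f ` X| \<le>o |UNIV :: ('a + nat) set|"
proof -
  have "|X| \<le>o |UNIV :: ('a + nat) set|"
    by (rule card_of_ordLeq[THEN iffD1]) (auto intro!: exI[of _ Inl])
  then show ?thesis using card_of_image ordLeq_transitive by blast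
qed

theorem mv_epi_cancel:
  fixes M :: "'a mv" and A :: "'b mv" and N :: "'c mv"
  assumes "mv_epi M A f" "mv_algebra A" "mv_algebra N"
    and \<alpha>: "\<alpha> \<in> mv_hom A N" and \<beta>: "\<beta> \<in> mv_hom A N"
    and eq: "\<And>x. x \<in> carrier M \<Longrightarrow> \<alpha> (f x) = \<beta> (f x)" and y: "y \<in> carrier A"
  shows "\<alpha> y = \<beta> y"
proof -
  interpret N: mv_algebra N by fact
  let ?X = "\<alpha> ` carrier A \<union> \<beta> ` carrier A"
  have X: "|?X| \<le>o |UNIV :: ('b + nat) set|"
    by (intro card_of_Un_le infinite_plus_nat card_le_plus_nat)
  have "?X \<subseteq> carrier N" using \<alpha> \<beta> by (auto simp: mv_hom_def)
  from small_closure[OF infinite_plus_nat X this,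
      of "\<lambda>x y. {oplus N x y, neg N x, bot0 N, top1 N}"]
  obtain Y where Y: "?X \<subseteq> Y" "Y \<subseteq> carrier N" "|Y| \<le>o |UNIV :: ('b + nat) set|"
    "\<forall>x\<in>Y. \<forall>y\<in>Y. {oplus N x y, neg N x, bot0 N, top1 N} \<subseteq> Y"
    using N.mv_simps(1-3) N.neg_closed by auto
  then have clo: "mv_closed N Y" using y unfolding mv_closed_def by blast
  obtain i :: "'c \<Rightarrow> 'b + nat" where i: "inj_on i Y"
    using Y(3) card_of_ordLeq[of Y "UNIV :: ('b + nat) set"] by blast
  have "(\<lambda>x. i (\<alpha> x)) \<in> mv_hom A (mv_transport i Y N)"
    "(\<lambda>x. i (\<beta> x)) \<in> mv_hom A (mv_transport i Y N)"
    using mv_transport_hom[OF clo i \<alpha>] mv_transport_hom[OF clo i \<beta>] Y(1) by auto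
  from assms(1)[unfolded mv_epi_def, THEN conjunct2, rule_format,
      OF mv_transport[OF assms(3) clo i] this _ y]
  have "i (\<alpha> y) = i (\<beta> y)" by (simp add: eq)
  moreover have "\<alpha> y \<in> Y" "\<beta> y \<in> Y" using y Y(1) by blast+
  ultimately show ?thesis by (rule inj_onD[OF i])
qed

datatype 'v mv_term = Var 'v | Plus "'v mv_term" "'v mv_term" | Neg "'v mv_term" | Zero | One

text \<open>
  Provable equality in the free product of two copies of the partial subalgebra of \<open>B\<close> on \<open>X\<close>,
  amalgamated over \<open>D\<close>.
\<close>

inductive amalg :: "'c mv \<Rightarrow> 'c set \<Rightarrow> 'c set \<Rightarrow> ('c \<times> bool) mv_term \<Rightarrow> ('c \<times> bool) mv_term \<Rightarrow> bool"
  for B D X where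
  a_refl: "amalg B D X s s"
| a_sym: "amalg B D X s t \<Longrightarrow> amalg B D X t s"
| a_trans: "amalg B D X s t \<Longrightarrow> amalg B D X t v \<Longrightarrow> amalg B D X s v"
| a_Plus: "amalg B D X s s' \<Longrightarrow> amalg B D X t t' \<Longrightarrow> amalg B D X (Plus s t) (Plus s' t')"
| a_Neg: "amalg B D X s s' \<Longrightarrow> amalg B D X (Neg s) (Neg s')"
| a_assoc: "amalg B D X (Plus (Plus s t) v) (Plus s (Plus t v))"
| a_comm: "amalg B D X (Plus s t) (Plus t s)"
| a_zero: "amalg B D X (Plus Zero s) s"
| a_one: "amalg B D X One (Neg Zero)"
| a_neg_neg: "amalg B D X (Neg (Neg s)) s"
| a_plus_one: "amalg B D X (Plus s One) One"
| a_luk: "amalg B D X (Plus s (Neg (Plus s (Neg t)))) (Plus t (Neg (Plus t (Neg s))))"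
| v_plus: "\<lbrakk>x \<in> X; y \<in> X; oplus B x y \<in> X\<rbrakk> \<Longrightarrow>
    amalg B D X (Var (oplus B x y, k)) (Plus (Var (x, k)) (Var (y, k)))"
| v_neg: "\<lbrakk>x \<in> X; neg B x \<in> X\<rbrakk> \<Longrightarrow> amalg B D X (Var (neg B x, k)) (Neg (Var (x, k)))"
| v_zero: "bot0 B \<in> X \<Longrightarrow> amalg B D X (Var (bot0 B, k)) Zero"
| v_one: "top1 B \<in> X \<Longrightarrow> amalg B D X (Var (top1 B, k)) One"
| v_glue: "d \<in> D \<Longrightarrow> d \<in> X \<Longrightarrow> amalg B D X (Var (d, True)) (Var (d, False))"

lemma amalg_mono:
  assumes "amalg B D X s t" "X \<subseteq> Y" shows "amalg B D Y s t"
  using assms by (induction) (auto intro: amalg.intros)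

lemma amalg_finite:
  assumes "amalg B D X s t" shows "\<exists>F. finite F \<and> F \<subseteq> X \<and> amalg B D F s t"
  using assms
proof induction
  case (a_trans s t v)
  then obtain F G where "finite F" "F \<subseteq> X" "amalg B D F s t" "finite G" "G \<subseteq> X" "amalg B D G t v"
    by blast
  then show ?case
    by (intro exI[of _ "F \<union> G"]) (auto intro: amalg.a_trans amalg_mono)
next
  case (a_Plus s s' t t')
  then obtain F G where "finite F" "F \<subseteq> X" "amalg B D F s s'" "finite G" "G \<subseteq> X" "amalg B D G t t'"
    by blast
  then show ?case
    by (intro exI[of _ "F \<union> G"]) (auto intro: amalg.a_Plus amalg_mono)
next
  case (v_plus x y k)
  then show ?case by (intro exI[of _ "{x, y, oplus B x y}"]) (auto intro: amalg.v_plus)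
next
  case (v_neg x k)
  then show ?case by (intro exI[of _ "{x, neg B x}"]) (auto intro: amalg.v_neg)
next
  case (v_zero k)
  then show ?case by (intro exI[of _ "{bot0 B}"]) (auto intro: amalg.v_zero)
next
  case (v_one k)
  then show ?case by (intro exI[of _ "{top1 B}"]) (auto intro: amalg.v_one)
next
  case (v_glue d)
  then show ?case by (intro exI[of _ "{d}"]) (auto intro: amalg.v_glue)
qed (blast intro: amalg.intros)+

lemma epi_amalg:
  assumes epi: "mv_epi M B f" and B: "mv_algebra B" and b: "b \<in> carrier B"
  shows "amalg B (f ` carrier M) (carrier B) (Var (b, True)) (Var (b, False))"
proof -
  interpret B: mv_algebra B by fact
  let ?R = "amalg B (f ` carrier M) (carrier B)"
  define r where "r t = (SOME s. ?R t s)" for t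
  have r: "?R t (r t)" for t unfolding r_def by (rule someI) (rule a_refl)
  have r_eq: "r s = r t \<longleftrightarrow> ?R s t" for s t
  proof
    assume "r s = r t" then show "?R s t" by (metis r a_sym a_trans)
  next
    assume "?R s t" then have "?R s = ?R t" by (intro ext) (metis a_sym a_trans)
    then show "r s = r t" by (simp add: r_def)
  qed
  have rP: "r (Plus (r s) t) = r (Plus s t)" "r (Plus s (r t)) = r (Plus s t)"
    and rN: "r (Neg (r s)) = r (Neg s)" and rr: "r (r s) = r s" for s t
    unfolding r_eq by (meson r a_sym a_refl a_Plus a_Neg)+
  define R where "R = range r"
  have R: "r t \<in> R" for t by (simp add: R_def)
  have rx: "r x = x" "r (Plus Zero x) = x" "r (Neg (Neg x)) = x" if "x \<in> R" for x
  proof -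
    show "r x = x" using that rr by (auto simp: R_def)
    then show "r (Plus Zero x) = x" "r (Neg (Neg x)) = x"
      using a_zero a_neg_neg r_eq by metis+
  qed
  define Q where "Q = \<lparr>carrier = R, oplus = (\<lambda>s t. r (Plus s t)),
    neg = (\<lambda>s. r (Neg s)), bot0 = r Zero, top1 = r One\<rparr>"
  have Q: "mv_algebra Q"
    by (rule mv_algebraI)
      (simp_all add: Q_def R rP rN rx, simp_all add: r_eq a_assoc a_comm a_one a_plus_one a_luk)
  have hom: "(\<lambda>x. r (Var (x, k))) \<in> mv_hom B Q" for k
    by (auto simp: mv_hom_def Q_def R rP rN r_eq B.mv_simps(1-3) B.neg_closed
        intro: v_plus v_neg v_zero v_one)
  have fB: "f x \<in> carrier B" if "x \<in> carrier M" for x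
    using epi that by (auto simp: mv_epi_def mv_hom_def)
  have "r (Var (b, True)) = r (Var (b, False))"
    by (rule mv_epi_cancel[OF epi B Q hom hom _ b]) (auto simp: r_eq fB intro: v_glue)
  then show ?thesis by (simp add: r_eq)
qed

primrec mv_eval :: "'b mv \<Rightarrow> ('v \<Rightarrow> 'b) \<Rightarrow> 'v mv_term \<Rightarrow> 'b" where
  "mv_eval N e (Var v) = e v"
| "mv_eval N e (Plus s t) = mv_eval N e s \<oplus>\<^bsub>N\<^esub> mv_eval N e t"
| "mv_eval N e (Neg s) = \<sim>\<^bsub>N\<^esub> mv_eval N e s"
| "mv_eval N e Zero = \<^bold>0\<^bsub>N\<^esub>"
| "mv_eval N e One = \<^bold>1\<^bsub>N\<^esub>"

lemma amalg_sound:
  assumes N: "mv_algebra N" and am: "amalg B D Y s t"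
    and e: "\<And>v. e v \<in> carrier N"
    and h: "\<And>x y k. \<lbrakk>x \<in> Y; y \<in> Y; oplus B x y \<in> Y\<rbrakk> \<Longrightarrow> e (oplus B x y, k) = oplus N (e (x, k)) (e (y, k))"
      "\<And>x k. \<lbrakk>x \<in> Y; neg B x \<in> Y\<rbrakk> \<Longrightarrow> e (neg B x, k) = neg N (e (x, k))"
      "\<And>k. e (bot0 B, k) = bot0 N" "\<And>k. e (top1 B, k) = top1 N"
      "\<And>d. d \<in> D \<Longrightarrow> d \<in> Y \<Longrightarrow> e (d, True) = e (d, False)"
  shows "mv_eval N e s = mv_eval N e t"
proof -
  interpret mv_algebra N by fact
  have ev: "mv_eval N e u \<in> carrier N" for u
    by (induction u) (auto simp: e mv_simps(1-3) neg_closed)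
  show ?thesis using am
  proof induction
    case (a_comm s t) show ?case using mv_simps(5) ev by simp
  next
    case (a_luk s t) show ?case using lukasiewicz ev by simp
  next
    case a_one show ?case using top1_eq by simp
  qed (simp_all add: h ev mv_simps(4,6) neg_neg oplus_top1)
qed

theorem epicomplete_surj:
  fixes M :: "'a mv" and B :: "'b mv"
  assumes M: "mv_algebra M" and ec: "epicomplete M" and B: "mv_algebra B" and epi: "mv_epi M B f"
  shows "f ` carrier M = carrier B"
proof
  interpret B: mv_algebra B by fact
  let ?D = "f ` carrier M"
  have f: "f \<in> mv_hom M B" using epi by (simp add: mv_epi_def)
  then show DB: "?D \<subseteq> carrier B" by (auto simp: mv_hom_def)
  show "carrier B \<subseteq> ?D"
  proof
    fix b assume b: "b \<in> carrier B"
    have "\<exists>F. finite F \<and> F \<subseteq> carrier B \<and> amalg B ?D F (Var (x, True)) (Var (x, False))"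
      if "x \<in> carrier B" for x
      using amalg_finite[OF epi_amalg[OF epi B that]] .
    then obtain F where F: "\<And>x. x \<in> carrier B \<Longrightarrow> finite (F x) \<and> F x \<subseteq> carrier B \<and>
      amalg B ?D (F x) (Var (x, True)) (Var (x, False))" by metis
    let ?g = "\<lambda>x y. {oplus B x y, neg B x, bot0 B, top1 B} \<union> F x"
    have fin: "|{b}| \<le>o |UNIV :: ('a + nat) set|"
      by (rule card_of_ordLeq[THEN iffD1]) (auto intro!: exI[of _ "\<lambda>_. Inr 0"])
    have X: "|?D \<union> {b}| \<le>o |UNIV :: ('a + nat) set|"
      by (intro card_of_Un_le infinite_plus_nat card_le_plus_nat fin)
    have "?D \<union> {b} \<subseteq> carrier B" using DB b by auto
    from small_closure[OF infinite_plus_nat X this, of ?g]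
    obtain Y where Y: "?D \<union> {b} \<subseteq> Y" "Y \<subseteq> carrier B" "|Y| \<le>o |UNIV :: ('a + nat) set|"
      "\<forall>x\<in>Y. \<forall>y\<in>Y. ?g x y \<subseteq> Y"
      using B.mv_simps(1-3) B.neg_closed F by auto
    then have clo: "mv_closed B Y" unfolding mv_closed_def by blast
    obtain i :: "'b \<Rightarrow> 'a + nat" where i: "inj_on i Y"
      using Y(3) card_of_ordLeq[of Y "UNIV :: ('a + nat) set"] by blast
    let ?A = "mv_transport i Y B"
    have A: "mv_algebra ?A" by (rule mv_transport[OF B clo i])
    have inv: "the_inv_into Y i (i x) = x" if "x \<in> Y" for x
      using that i by (simp add: the_inv_into_f_f)
    have "mv_epi M ?A (\<lambda>x. i (f x))"
      unfolding mv_epi_def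
    proof (intro conjI allI impI ballI)
      show "(\<lambda>x. i (f x)) \<in> mv_hom M ?A"
        using mv_transport_hom[OF clo i f] Y(1) by auto
    next
      fix N :: "(('a + nat) + nat) mv" and \<alpha> \<beta> y
      assume N: "mv_algebra N" and \<alpha>: "\<alpha> \<in> mv_hom ?A N" and \<beta>: "\<beta> \<in> mv_hom ?A N"
        and eq: "\<forall>x\<in>carrier M. \<alpha> (i (f x)) = \<beta> (i (f x))" and y: "y \<in> carrier ?A"
      interpret N: mv_algebra N by fact
      obtain x where x: "x \<in> Y" "y = i x" using y by (auto simp: mv_transport_def)
      define e where "e v = (if fst v \<in> Y then if snd v then \<alpha> (i (fst v)) else \<beta> (i (fst v))
        else bot0 N)" for v
      have hom_plus: "h (i (oplus B x y)) = oplus N (h (i x)) (h (i y))"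
        if "h \<in> mv_hom ?A N" "x \<in> Y" "y \<in> Y" for h x y
        using that by (auto simp: mv_hom_def mv_transport_def inv)
      have hom_neg: "h (i (neg B x)) = neg N (h (i x))" and hom_car: "h (i x) \<in> carrier N"
        if "h \<in> mv_hom ?A N" "x \<in> Y" for h x
        using that by (auto simp: mv_hom_def mv_transport_def inv Pi_iff)
      have hom_const: "h (i (bot0 B)) = bot0 N" "h (i (top1 B)) = top1 N"
        if "h \<in> mv_hom ?A N" for h
        using that by (auto simp: mv_hom_def mv_transport_def)
      have b01: "bot0 B \<in> Y" "top1 B \<in> Y" using clo by (auto simp: mv_closed_def)
      have "x \<in> carrier B" "F x \<subseteq> Y" using x(1) Y(2,4) by auto
      then have "amalg B ?D Y (Var (x, True)) (Var (x, False))"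
        using F amalg_mono by blast
      then have "mv_eval N e (Var (x, True)) = mv_eval N e (Var (x, False))"
      proof (rule amalg_sound[OF N])
        show "e v \<in> carrier N" for v
          using hom_car[OF \<alpha>] hom_car[OF \<beta>] N.mv_simps(2) by (simp add: e_def)
        show "e (oplus B x y, k) = oplus N (e (x, k)) (e (y, k))"
          if "x \<in> Y" "y \<in> Y" "oplus B x y \<in> Y" for x y k
          using that hom_plus[OF \<alpha>] hom_plus[OF \<beta>] by (simp add: e_def)
        show "e (neg B x, k) = neg N (e (x, k))" if "x \<in> Y" "neg B x \<in> Y" for x k
          using that hom_neg[OF \<alpha>] hom_neg[OF \<beta>] by (simp add: e_def)
        show "e (bot0 B, k) = bot0 N" "e (top1 B, k) = top1 N" for k
          using b01 hom_const[OF \<alpha>] hom_const[OF \<beta>] by (simp_all add: e_def)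
        show "e (d, True) = e (d, False)" if "d \<in> ?D" "d \<in> Y" for d
          using that eq by (auto simp: e_def)
      qed
      then show "\<alpha> y = \<beta> y" using x by (simp add: e_def)
    qed
    then have "(\<lambda>x. i (f x)) ` carrier M = carrier ?A"
      using ec A unfolding epicomplete_def by blast
    then have "i b \<in> (\<lambda>x. i (f x)) ` carrier M" using Y(1) by (auto simp: mv_transport_def)
    then obtain m where m: "m \<in> carrier M" "i b = i (f m)" by blast
    have "b = f m" by (rule inj_onD[OF i m(2)]) (use m(1) Y(1) in auto)
    then show "b \<in> ?D" using m(1) by blast
  qed
qed

end

theory Submission
  imports Defs
begin

text \<open>
  If \<open>h : M \<rightarrow> N\<close> is an embedding and \<open>x \<in> N\<close> is an \<open>n\<close>-th part of \<open>h a\<close>, let \<open>B\<close> be the subalgebra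
  of \<open>N\<close> generated by \<open>h M\<close> and \<open>x\<close>. In any MV-algebra \<open>n\<close>-th parts are unique, so \<open>h : M \<rightarrow> B\<close> is
  an epimorphism, hence surjective, and the preimage of \<open>x\<close> divides \<open>a\<close> in \<open>M\<close>.
  Such an \<open>N\<close> exists because \<open>M\<close> embeds into the product of the chains \<open>M/P\<close> for prime ideals
  \<open>P\<close>, and each chain \<open>C\<close> is the unit interval of its Chang group \<open>G\<close> with unit \<open>u\<close>: scaling
  by \<open>n\<close> embeds \<open>\<Gamma>(G, u)\<close> into \<open>\<Gamma>(G, nu)\<close>, where \<open>c\<close> itself is the \<open>n\<close>-th part of the
  image \<open>nc\<close> of \<open>c\<close>.
\<close>

section \<open>Arithmetic and order\<close>

context mv_algebra
begin

text \<open>In the real unit interval, \<open>odot\<close> is max(0, x + y - 1), \<open>le\<close>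
  is the usual order and \<open>ominus\<close> is max(0, x - y).\<close>

definition odot (infixl "\<odot>" 70) where "x \<odot> y = \<sim> (\<sim> x \<oplus> \<sim> y)"

definition le (infix "\<preceq>" 50) where "x \<preceq> y \<longleftrightarrow> \<sim> x \<oplus> y = \<^bold>1"

definition ominus (infixl "\<ominus>" 65) where "x \<ominus> y = \<sim> (\<sim> x \<oplus> y)"

lemmas oplus_closed = mv_simps(1) and bot0_closed = mv_simps(2) and top1_closed = mv_simps(3)
  and oplus_assoc = mv_simps(4) and oplus_comm = mv_simps(5) and bot0_oplus = mv_simps(6)

declare oplus_closed [simp] bot0_closed [simp] top1_closed [simp] neg_closed [simp]
  neg_neg [simp] oplus_top1 [simp] bot0_oplus [simp]

lemma oplus_lcomm:
  "\<lbrakk>x \<in> carrier M; y \<in> carrier M; z \<in> carrier M\<rbrakk> \<Longrightarrow> x \<oplus> (y \<oplus> z) = y \<oplus> (x \<oplus> z)"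
  by (metis oplus_assoc oplus_comm)

lemmas oplus_ac = oplus_assoc oplus_comm oplus_lcomm

lemma neg_bot0 [simp]: "\<sim> \<^bold>0 = \<^bold>1" and neg_top1 [simp]: "\<sim> \<^bold>1 = \<^bold>0"
  using top1_eq by auto

lemma oplus_bot0 [simp]: "x \<in> carrier M \<Longrightarrow> x \<oplus> \<^bold>0 = x"
  and top1_oplus [simp]: "x \<in> carrier M \<Longrightarrow> \<^bold>1 \<oplus> x = \<^bold>1"
  using oplus_comm[of x "\<^bold>0"] oplus_comm[of "\<^bold>1" x] by simp_all

lemma odot_closed [simp]: "\<lbrakk>x \<in> carrier M; y \<in> carrier M\<rbrakk> \<Longrightarrow> x \<odot> y \<in> carrier M"
  and ominus_closed [simp]: "\<lbrakk>x \<in> carrier M; y \<in> carrier M\<rbrakk> \<Longrightarrow> x \<ominus> y \<in> carrier M"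
  by (simp_all add: odot_def ominus_def)

lemma oplus_neg [simp]: "x \<in> carrier M \<Longrightarrow> x \<oplus> \<sim> x = \<^bold>1"
  and neg_oplus [simp]: "x \<in> carrier M \<Longrightarrow> \<sim> x \<oplus> x = \<^bold>1"
  using lukasiewicz[of x "\<^bold>1"] oplus_comm[of "\<sim> x" x] by simp_all

lemma odot_assoc: "\<lbrakk>x \<in> carrier M; y \<in> carrier M; z \<in> carrier M\<rbrakk> \<Longrightarrow> x \<odot> y \<odot> z = x \<odot> (y \<odot> z)"
  and odot_comm: "\<lbrakk>x \<in> carrier M; y \<in> carrier M\<rbrakk> \<Longrightarrow> x \<odot> y = y \<odot> x"
  and odot_lcomm:
    "\<lbrakk>x \<in> carrier M; y \<in> carrier M; z \<in> carrier M\<rbrakk> \<Longrightarrow> x \<odot> (y \<odot> z) = y \<odot> (x \<odot> z)"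
  by (simp_all add: odot_def oplus_ac)

lemma neg_eq_iff: "\<lbrakk>x \<in> carrier M; y \<in> carrier M\<rbrakk> \<Longrightarrow> \<sim> x = \<sim> y \<longleftrightarrow> x = y"
  by (metis neg_neg)

lemma neg_eq_bot0_iff: "x \<in> carrier M \<Longrightarrow> \<sim> x = \<^bold>0 \<longleftrightarrow> x = \<^bold>1"
  by (metis neg_neg neg_bot0 neg_top1)

lemma le_refl [simp]: "x \<in> carrier M \<Longrightarrow> x \<preceq> x"
  by (simp add: le_def)

text \<open>Under both inequalities the left side of the Lukasiewicz axiom collapses to
  \<open>x\<close> and the right side to \<open>y\<close>.\<close>

lemma le_antisym: "\<lbrakk>x \<preceq> y; y \<preceq> x; x \<in> carrier M; y \<in> carrier M\<rbrakk> \<Longrightarrow> x = y"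
  using lukasiewicz[of x y] by (simp add: le_def oplus_comm)

lemma le_oplus1 [simp]: "\<lbrakk>x \<in> carrier M; y \<in> carrier M\<rbrakk> \<Longrightarrow> x \<preceq> x \<oplus> y"
  by (simp add: le_def oplus_assoc[symmetric])

lemma le_oplus2 [simp]: "\<lbrakk>x \<in> carrier M; y \<in> carrier M\<rbrakk> \<Longrightarrow> y \<preceq> x \<oplus> y"
  using le_oplus1[of y x] by (simp add: oplus_comm)

text \<open>Both sides of the Lukasiewicz axiom are the join, here \<open>y\<close>. This yields the
  witness \<open>\<sim> (x \<oplus> \<sim> y)\<close>, which is
  \<open>y \<ominus> x\<close>.\<close>

lemma le_iff_exists:
  assumes "x \<in> carrier M" "y \<in> carrier M"
  shows "x \<preceq> y \<longleftrightarrow> (\<exists>z\<in>carrier M. y = x \<oplus> z)"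
proof
  assume "x \<preceq> y"
  then have "y = x \<oplus> \<sim> (x \<oplus> \<sim> y)"
    using lukasiewicz[of x y] assms by (simp add: le_def oplus_comm)
  then show "\<exists>z\<in>carrier M. y = x \<oplus> z" using assms by (meson neg_closed oplus_closed)
qed (use assms in auto)

lemma le_trans [trans]:
  "\<lbrakk>x \<preceq> y; y \<preceq> z; x \<in> carrier M; y \<in> carrier M; z \<in> carrier M\<rbrakk> \<Longrightarrow> x \<preceq> z"
  by (metis le_iff_exists oplus_assoc oplus_closed)

lemma bot0_le [simp]: "x \<in> carrier M \<Longrightarrow> \<^bold>0 \<preceq> x"
  and le_top1 [simp]: "x \<in> carrier M \<Longrightarrow> x \<preceq> \<^bold>1"
  by (simp_all add: le_def)

lemma le_bot0_iff: "x \<in> carrier M \<Longrightarrow> x \<preceq> \<^bold>0 \<longleftrightarrow> x = \<^bold>0"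
  by (metis bot0_closed bot0_le le_antisym le_refl)

lemma top1_le_iff: "x \<in> carrier M \<Longrightarrow> \<^bold>1 \<preceq> x \<longleftrightarrow> x = \<^bold>1"
  by (metis top1_closed le_top1 le_antisym le_refl)

lemma neg_le_iff: "\<lbrakk>x \<in> carrier M; y \<in> carrier M\<rbrakk> \<Longrightarrow> \<sim> x \<preceq> \<sim> y \<longleftrightarrow> y \<preceq> x"
  by (simp add: le_def oplus_comm)

lemma oplus_mono:
  assumes "x \<preceq> x'" "y \<preceq> y'" "x \<in> carrier M" "x' \<in> carrier M" "y \<in> carrier M" "y' \<in> carrier M"
  shows "x \<oplus> y \<preceq> x' \<oplus> y'"
proof -
  obtain u v where "u \<in> carrier M" "v \<in> carrier M" "x' = x \<oplus> u" "y' = y \<oplus> v"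
    using assms le_iff_exists by metis
  moreover from this have "x' \<oplus> y' = (x \<oplus> y) \<oplus> (u \<oplus> v)" using assms by (simp add: oplus_ac)
  ultimately show ?thesis using assms by simp
qed

lemma odot_mono:
  "\<lbrakk>x \<preceq> x'; y \<preceq> y'; x \<in> carrier M; x' \<in> carrier M; y \<in> carrier M; y' \<in> carrier M\<rbrakk> \<Longrightarrow>
    x \<odot> y \<preceq> x' \<odot> y'"
  unfolding odot_def by (simp add: neg_le_iff oplus_mono)

lemma odot_le1: "\<lbrakk>x \<in> carrier M; y \<in> carrier M\<rbrakk> \<Longrightarrow> x \<odot> y \<preceq> x"
  unfolding odot_def by (metis le_oplus1 neg_closed neg_le_iff neg_neg oplus_closed)

lemma odot_le2: "\<lbrakk>x \<in> carrier M; y \<in> carrier M\<rbrakk> \<Longrightarrow> x \<odot> y \<preceq> y"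
  using odot_le1[of y x] by (simp add: odot_comm)

lemma odot_neg [simp]: "x \<in> carrier M \<Longrightarrow> x \<odot> \<sim> x = \<^bold>0" "x \<in> carrier M \<Longrightarrow> \<sim> x \<odot> x = \<^bold>0"
  by (simp_all add: odot_def)

lemma odot_const [simp]: "x \<in> carrier M \<Longrightarrow> x \<odot> \<^bold>1 = x" "x \<in> carrier M \<Longrightarrow> \<^bold>1 \<odot> x = x"
  "x \<in> carrier M \<Longrightarrow> x \<odot> \<^bold>0 = \<^bold>0" "x \<in> carrier M \<Longrightarrow> \<^bold>0 \<odot> x = \<^bold>0"
  by (simp_all add: odot_def)

lemma odot_bot0_iff: "\<lbrakk>x \<in> carrier M; y \<in> carrier M\<rbrakk> \<Longrightarrow> x \<odot> y = \<^bold>0 \<longleftrightarrow> x \<preceq> \<sim> y"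
  by (simp add: odot_def le_def neg_eq_bot0_iff)

lemma ominus_eq_odot: "\<lbrakk>x \<in> carrier M; y \<in> carrier M\<rbrakk> \<Longrightarrow> x \<ominus> y = x \<odot> \<sim> y"
  by (simp add: ominus_def odot_def)

text \<open>Residuation: unfolded, both sides say that the sum of \<open>\<sim> x\<close>,
  \<open>y\<close> and \<open>z\<close> is the top, differing only in the brackets.\<close>

lemma ominus_le_iff:
  "\<lbrakk>x \<in> carrier M; y \<in> carrier M; z \<in> carrier M\<rbrakk> \<Longrightarrow> x \<ominus> y \<preceq> z \<longleftrightarrow> x \<preceq> y \<oplus> z"
  by (simp add: ominus_def le_def oplus_assoc)

lemma ominus_bot0_iff: "\<lbrakk>x \<in> carrier M; y \<in> carrier M\<rbrakk> \<Longrightarrow> x \<ominus> y = \<^bold>0 \<longleftrightarrow> x \<preceq> y"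
  by (simp add: ominus_def le_def neg_eq_bot0_iff)

lemma le_oplus_ominus: "\<lbrakk>x \<in> carrier M; y \<in> carrier M\<rbrakk> \<Longrightarrow> x \<preceq> y \<oplus> (x \<ominus> y)"
  by (simp add: ominus_le_iff[symmetric])

lemma ominus_le: "\<lbrakk>x \<in> carrier M; y \<in> carrier M\<rbrakk> \<Longrightarrow> x \<ominus> y \<preceq> x"
  by (simp add: ominus_le_iff)

lemma ominus_self [simp]: "x \<in> carrier M \<Longrightarrow> x \<ominus> x = \<^bold>0"
  by (simp add: ominus_bot0_iff)

lemma neg_ominus_neg: "\<lbrakk>x \<in> carrier M; y \<in> carrier M\<rbrakk> \<Longrightarrow> \<sim> x \<ominus> \<sim> y = y \<ominus> x"
  by (simp add: ominus_def oplus_comm)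

lemma ominus_triangle:
  assumes "x \<in> carrier M" "y \<in> carrier M" "z \<in> carrier M"
  shows "x \<ominus> z \<preceq> (x \<ominus> y) \<oplus> (y \<ominus> z)"
proof -
  have "x \<preceq> y \<oplus> (x \<ominus> y)" using assms by (simp add: le_oplus_ominus)
  also have "y \<oplus> (x \<ominus> y) \<preceq> (z \<oplus> (y \<ominus> z)) \<oplus> (x \<ominus> y)"
    using assms by (intro oplus_mono) (simp_all add: le_oplus_ominus)
  finally show ?thesis using assms by (simp add: ominus_le_iff oplus_ac)
qed

lemma oplus_ominus_oplus:
  assumes "x \<in> carrier M" "y \<in> carrier M" "x' \<in> carrier M" "y' \<in> carrier M"
  shows "(x \<oplus> y) \<ominus> (x' \<oplus> y') \<preceq> (x \<ominus> x') \<oplus> (y \<ominus> y')"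
proof -
  have "x \<oplus> y \<preceq> (x' \<oplus> (x \<ominus> x')) \<oplus> (y' \<oplus> (y \<ominus> y'))"
    using assms by (intro oplus_mono) (simp_all add: le_oplus_ominus)
  then show ?thesis using assms by (simp add: ominus_le_iff oplus_ac)
qed

text \<open>The Lukasiewicz axiom for complements. Both sides are the meet of \<open>x\<close> and
  \<open>y\<close>, and this term serves as the meet from here on.\<close>

lemma odot_residual:
  assumes "x \<in> carrier M" "y \<in> carrier M"
  shows "x \<odot> (\<sim> x \<oplus> y) = y \<odot> (\<sim> y \<oplus> x)"
  using lukasiewicz[of "\<sim> x" "\<sim> y"] assms by (simp add: odot_def)

lemma odot_residual_le:
  assumes "x \<preceq> y" "x \<in> carrier M" "y \<in> carrier M"
  shows "y \<odot> (\<sim> y \<oplus> x) = x"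
  using assms odot_residual[of x y] by (simp add: le_def)

text \<open>The term is the meet of the two differences. Rewriting meets by
  \<open>odot_residual\<close> turns it into a product with one factor below \<open>?q\<close> and
  the other below \<open>\<sim> ?q\<close>, hence zero.\<close>

lemma ominus_inf_ominus:
  assumes x: "x \<in> carrier M" and y: "y \<in> carrier M"
  shows "(x \<ominus> y) \<odot> (\<sim> (x \<ominus> y) \<oplus> (y \<ominus> x)) = \<^bold>0"
proof -
  let ?q = "y \<ominus> x" let ?w = "y \<oplus> ?q"
  have q: "\<sim> ?q = x \<oplus> \<sim> y" using x y by (simp add: ominus_def oplus_comm)
  have "(x \<ominus> y) \<odot> (\<sim> (x \<ominus> y) \<oplus> ?q) = \<sim> y \<odot> (x \<odot> (\<sim> x \<oplus> ?w))"
    using x y by (simp add: ominus_eq_odot odot_assoc odot_comm odot_lcomm) (simp add: odot_def oplus_ac)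
  also have "\<dots> = (\<sim> y \<odot> ?w) \<odot> (\<sim> ?w \<oplus> x)"
    using x y by (simp add: odot_residual[of x ?w] odot_assoc)
  also have "\<sim> y \<odot> ?w = ?q \<odot> (\<sim> ?q \<oplus> \<sim> y)"
    using x y odot_residual[of "\<sim> y" ?q] by simp
  also have "?q \<odot> (\<sim> ?q \<oplus> \<sim> y) \<odot> (\<sim> ?w \<oplus> x) \<preceq> ?q \<odot> \<sim> ?q"
  proof (rule odot_mono)
    have "\<sim> ?w \<preceq> \<sim> y" using x y by (simp add: neg_le_iff)
    then show "\<sim> ?w \<oplus> x \<preceq> \<sim> ?q"
      unfolding q using x y oplus_mono[of "\<sim> ?w" "\<sim> y" x x] by (simp add: oplus_comm)
  qed (use x y in \<open>simp_all add: odot_le1\<close>)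
  finally show ?thesis using x y by (simp add: le_bot0_iff)
qed

text \<open>A common lower bound lies below the meet, which is zero by
  \<open>ominus_inf_ominus\<close>.\<close>

lemma ominus_disjoint:
  assumes "t \<preceq> x \<ominus> y" "t \<preceq> y \<ominus> x" and c: "t \<in> carrier M" "x \<in> carrier M" "y \<in> carrier M"
  shows "t = \<^bold>0"
proof -
  let ?a = "x \<ominus> y" and ?b = "y \<ominus> x"
  have "t = ?a \<odot> (\<sim> ?a \<oplus> t)" using assms by (simp add: odot_residual_le)
  also have "\<dots> \<preceq> ?a \<odot> (\<sim> ?a \<oplus> ?b)"
    using assms by (intro odot_mono oplus_mono) simp_all
  finally show ?thesis using c by (simp add: ominus_inf_ominus le_bot0_iff)
qed

text \<open>Disjointness is phrased as having only zero as a common lower bound. Here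
  \<open>t \<ominus> v\<close> is below \<open>u\<close> and \<open>w\<close>, hence zero, so
  \<open>t\<close> is below \<open>u\<close> and \<open>v\<close>.\<close>

lemma disjoint_oplus:
  assumes uv: "\<And>t. \<lbrakk>t \<in> carrier M; t \<preceq> u; t \<preceq> v\<rbrakk> \<Longrightarrow> t = \<^bold>0"
    and uw: "\<And>t. \<lbrakk>t \<in> carrier M; t \<preceq> u; t \<preceq> w\<rbrakk> \<Longrightarrow> t = \<^bold>0"
    and c: "u \<in> carrier M" "v \<in> carrier M" "w \<in> carrier M" "t \<in> carrier M"
    and t: "t \<preceq> u" "t \<preceq> v \<oplus> w"
  shows "t = \<^bold>0"
proof -
  have "t \<ominus> v \<preceq> u" using c t(1) by (meson le_trans ominus_le ominus_closed)
  moreover have "t \<ominus> v \<preceq> w" using c t(2) by (simp add: ominus_le_iff)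
  ultimately have "t \<ominus> v = \<^bold>0" using c uw by simp
  then show ?thesis using uv c t(1) by (simp add: ominus_bot0_iff)
qed

lemma multiple_Suc [simp]: "x \<in> carrier M \<Longrightarrow> multiple M (Suc k) x = multiple M k x \<oplus> x"
  by (cases k) simp_all

lemma multiple_closed [simp]: "x \<in> carrier M \<Longrightarrow> multiple M k x \<in> carrier M"
  by (induction k) (simp_all del: multiple.simps(2,3))

lemma multiple_add:
  "x \<in> carrier M \<Longrightarrow> multiple M (j + k) x = multiple M j x \<oplus> multiple M k x"
  by (induction k) (simp_all del: multiple.simps(2,3) add: oplus_assoc)

lemma disjoint_multiple:
  assumes "\<And>t. \<lbrakk>t \<in> carrier M; t \<preceq> u; t \<preceq> v\<rbrakk> \<Longrightarrow> t = \<^bold>0"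
    and "u \<in> carrier M" "v \<in> carrier M" "t \<in> carrier M" "t \<preceq> u" "t \<preceq> multiple M k v"
  shows "t = \<^bold>0"
  using assms(4-6)
proof (induction k arbitrary: t)
  case 0 then show ?case by (simp add: le_bot0_iff)
next
  case (Suc k)
  have t: "t \<preceq> multiple M k v \<oplus> v" using Suc.prems(3) assms(3) by (simp del: multiple.simps(2,3))
  show ?case
    by (rule disjoint_oplus[OF Suc.IH assms(1) assms(2) _ assms(3) Suc.prems(1,2) t])
      (use assms(3) in simp_all)
qed

text \<open>Iterates \<open>oplus_ominus_oplus\<close>. In \<open>division_unique\<close> it bounds
  a difference by a multiple of the opposite difference.\<close>

lemma multiple_ominus_multiple:
  assumes "x \<in> carrier M" "y \<in> carrier M"
  shows "multiple M k x \<ominus> multiple M k y \<preceq> multiple M k (x \<ominus> y)"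
proof (induction k)
  case (Suc k)
  have "multiple M (Suc k) x \<ominus> multiple M (Suc k) y \<preceq> (multiple M k x \<ominus> multiple M k y) \<oplus> (x \<ominus> y)"
    using assms by (simp del: multiple.simps(2,3) add: oplus_ominus_oplus)
  also have "\<dots> \<preceq> multiple M (Suc k) (x \<ominus> y)"
    using assms Suc by (simp del: multiple.simps(2,3) add: oplus_mono)
  finally show ?case using assms by (simp del: multiple.simps(2,3))
qed simp

end

section \<open>Prime ideals\<close>

context mv_algebra
begin

definition mv_ideal :: "'a set \<Rightarrow> bool" where
  "mv_ideal I \<longleftrightarrow> I \<subseteq> carrier M \<and> \<^bold>0 \<in> I \<and> (\<forall>x\<in>I. \<forall>y\<in>I. x \<oplus> y \<in> I) \<and>
     (\<forall>x\<in>I. \<forall>y\<in>carrier M. y \<preceq> x \<longrightarrow> y \<in> I)"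

text \<open>The last condition makes the quotient a chain; excluding the top makes the quotient
  nontrivial.\<close>

definition prime_ideal :: "'a set \<Rightarrow> bool" where
  "prime_ideal I \<longleftrightarrow> mv_ideal I \<and> \<^bold>1 \<notin> I \<and>
     (\<forall>x\<in>carrier M. \<forall>y\<in>carrier M. x \<ominus> y \<in> I \<or> y \<ominus> x \<in> I)"

lemma mv_idealD:
  assumes "mv_ideal I"
  shows "x \<in> I \<Longrightarrow> x \<in> carrier M" "\<^bold>0 \<in> I" "\<lbrakk>x \<in> I; y \<in> I\<rbrakk> \<Longrightarrow> x \<oplus> y \<in> I"
    "\<lbrakk>x \<in> I; y \<in> carrier M; y \<preceq> x\<rbrakk> \<Longrightarrow> y \<in> I"
  using assms by (auto simp: mv_ideal_def)

lemma multiple_in_ideal: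
  assumes I: "mv_ideal I" and x: "x \<in> I"
  shows "multiple M k x \<in> I"
proof (induction k)
  case 0 then show ?case using mv_idealD(2)[OF I] by simp
next
  case (Suc k)
  then show ?case using mv_idealD(1,3)[OF I] x by (simp del: multiple.simps(2,3))
qed

text \<open>\<open>J\<close> is the ideal generated by \<open>I\<close> and \<open>u\<close>; sums
  stay in it because multiples of \<open>u\<close> add up.\<close>

lemma ideal_adjoin:
  assumes I: "mv_ideal I" and u: "u \<in> carrier M"
  defines "J \<equiv> {y \<in> carrier M. \<exists>p\<in>I. \<exists>k. y \<preceq> p \<oplus> multiple M k u}"
  shows "mv_ideal J" "I \<subseteq> J" "u \<in> J"
proof -
  note I' = mv_idealD[OF I]
  have JI: "y \<in> J" if "y \<in> carrier M" "p \<in> I" "y \<preceq> p \<oplus> multiple M k u" for y p k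
    using that unfolding J_def by blast
  show "I \<subseteq> J"
    using I'(1) by (intro subsetI, rule_tac p = x and k = 0 in JI) simp_all
  show "u \<in> J"
    using I'(2) u by (intro JI[of u "\<^bold>0" "Suc 0"]) simp_all
  have "x \<oplus> y \<in> J" if xy: "x \<in> J" "y \<in> J" for x y
  proof -
    obtain p q j k where pq: "p \<in> I" "q \<in> I" "x \<preceq> p \<oplus> multiple M j u" "y \<preceq> q \<oplus> multiple M k u"
      and c: "x \<in> carrier M" "y \<in> carrier M" "p \<in> carrier M" "q \<in> carrier M"
      using xy I'(1) unfolding J_def by blast
    have "x \<oplus> y \<preceq> (p \<oplus> multiple M j u) \<oplus> (q \<oplus> multiple M k u)"
      using pq c u by (simp add: oplus_mono)
    also have "\<dots> = (p \<oplus> q) \<oplus> multiple M (j + k) u"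
      using c u by (simp add: multiple_add oplus_ac)
    finally show ?thesis using c pq(1,2) I'(3) by (intro JI[of _ "p \<oplus> q" "j + k"]) simp_all
  qed
  moreover have "y \<in> J" if xy: "x \<in> J" "y \<in> carrier M" "y \<preceq> x" for x y
  proof -
    obtain p k where p: "p \<in> I" "x \<preceq> p \<oplus> multiple M k u" and x: "x \<in> carrier M"
      using xy(1) unfolding J_def by blast
    have "y \<preceq> p \<oplus> multiple M k u"
      using le_trans[OF xy(3) p(2)] xy(2) x u I'(1)[OF p(1)] by simp
    then show ?thesis by (rule JI[OF xy(2) p(1)])
  qed
  moreover have "\<^bold>0 \<in> J" using \<open>I \<subseteq> J\<close> I'(2) by auto
  ultimately show "mv_ideal J" unfolding mv_ideal_def by (simp add: J_def)
qed

text \<open>By Zorn, take \<open>P\<close> maximal among the ideals omitting \<open>z\<close>. If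
  \<open>P\<close> contained neither difference, adjoining either one would capture
  \<open>z\<close>; disjointness of the two differences then forces \<open>z\<close> into
  \<open>P\<close> already.\<close>

lemma prime_ideal_avoiding:
  assumes z: "z \<in> carrier M" "z \<noteq> \<^bold>0"
  shows "\<exists>P. prime_ideal P \<and> z \<notin> P"
proof -
  let ?A = "{I. mv_ideal I \<and> z \<notin> I}"
  have "{\<^bold>0} \<in> ?A" using z by (auto simp: mv_ideal_def le_bot0_iff)
  moreover have "\<Union>C \<in> ?A" if "C \<noteq> {}" "subset.chain ?A C" for C
  proof -
    have C: "\<And>I. I \<in> C \<Longrightarrow> mv_ideal I \<and> z \<notin> I" and lin: "\<And>I J. I \<in> C \<Longrightarrow> J \<in> C \<Longrightarrow> I \<subseteq> J \<or> J \<subseteq> I"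
      using that(2) by (auto simp: subset.chain_def)
    have "x \<oplus> y \<in> \<Union>C" if xy: "x \<in> \<Union>C" "y \<in> \<Union>C" for x y
    proof -
      obtain I J where IJ: "I \<in> C" "x \<in> I" "J \<in> C" "y \<in> J" using xy by blast
      then have "x \<oplus> y \<in> I \<or> x \<oplus> y \<in> J" using lin[of I J] C mv_idealD(3) by blast
      then show ?thesis using IJ by blast
    qed
    then show ?thesis using C \<open>C \<noteq> {}\<close> unfolding mv_ideal_def by blast
  qed
  ultimately obtain P where P: "P \<in> ?A" and max: "\<And>I. I \<in> ?A \<Longrightarrow> P \<subseteq> I \<Longrightarrow> I = P"
    using subset_Zorn_nonempty[of ?A] by (metis (no_types, lifting) empty_iff)
  have id: "mv_ideal P" and zP: "z \<notin> P" using P by auto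
  have reach: "\<exists>p\<in>P. \<exists>k. z \<preceq> p \<oplus> multiple M k u" if u: "u \<in> carrier M" "u \<notin> P" for u
    using ideal_adjoin[OF id u(1)] max u(2) by blast
  have "x \<ominus> y \<in> P \<or> y \<ominus> x \<in> P" if xy: "x \<in> carrier M" "y \<in> carrier M" for x y
  proof (rule ccontr)
    assume "\<not> ?thesis"
    then obtain p q j k where p: "p \<in> P" "z \<preceq> p \<oplus> multiple M j (x \<ominus> y)"
      and q: "q \<in> P" "z \<preceq> q \<oplus> multiple M k (y \<ominus> x)"
      using reach xy by (metis ominus_closed)
    have c: "p \<in> carrier M" "q \<in> carrier M" using p q mv_idealD(1)[OF id] by auto
    \<comment> \<open>The part of \<open>z\<close> not accounted for by \<open>P\<close>. It lies
      below a multiple of each difference, so it must vanish.\<close>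
    define t where "t = z \<ominus> (p \<oplus> q)"
    have t: "t \<in> carrier M" using z c by (simp add: t_def)
    have "z \<preceq> (p \<oplus> q) \<oplus> multiple M j (x \<ominus> y)"
      using xy c z by (intro le_trans[OF p(2)] oplus_mono) simp_all
    then have t1: "t \<preceq> multiple M j (x \<ominus> y)" using xy c z by (simp add: t_def ominus_le_iff)
    have "z \<preceq> (p \<oplus> q) \<oplus> multiple M k (y \<ominus> x)"
      using xy c z by (intro le_trans[OF q(2)] oplus_mono) simp_all
    then have t2: "t \<preceq> multiple M k (y \<ominus> x)" using xy c z by (simp add: t_def ominus_le_iff)
    \<comment> \<open>\<open>disjoint_multiple\<close> takes a multiple on one side only, so it is
      applied twice with the roles exchanged.\<close>
    have "s = \<^bold>0" if "s \<in> carrier M" "s \<preceq> multiple M k (y \<ominus> x)" "s \<preceq> x \<ominus> y" for s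
      by (rule disjoint_multiple[OF _ _ _ that(1,3,2)]) (use xy ominus_disjoint in simp_all)
    then have "t = \<^bold>0"
      by (rule disjoint_multiple[OF _ _ _ t t2 t1]) (use xy in simp_all)
    then have "z \<preceq> p \<oplus> q" using z c by (simp add: t_def ominus_bot0_iff)
    then have "z \<in> P" using mv_idealD(4)[OF id mv_idealD(3)[OF id p(1) q(1)] z(1)] by simp
    then show False using zP by simp
  qed
  moreover have "\<^bold>1 \<notin> P" using zP mv_idealD(4)[OF id _ z(1) le_top1[OF z(1)]] by blast
  ultimately have "prime_ideal P" using id unfolding prime_ideal_def by blast
  then show ?thesis using zP by blast
qed

text \<open>Raising \<open>x\<close> raises the left side of the equation and lowers the right. If
  \<open>x\<close> is not below \<open>y\<close>, a prime ideal omitting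
  \<open>x \<ominus> y\<close> contains \<open>y \<ominus> x\<close>; but the equations put
  \<open>x \<ominus> y\<close> below a multiple of \<open>y \<ominus> x\<close>.\<close>

lemma division_unique:
  assumes c: "a \<in> carrier M" "x \<in> carrier M" "y \<in> carrier M"
    and x: "\<sim> a \<oplus> multiple M k x = \<sim> x" and y: "\<sim> a \<oplus> multiple M k y = \<sim> y"
  shows "x = y"
proof -
  have "x \<preceq> y" if c: "x \<in> carrier M" "y \<in> carrier M"
    and x: "\<sim> a \<oplus> multiple M k x = \<sim> x" and y: "\<sim> a \<oplus> multiple M k y = \<sim> y" for x y
  proof (rule ccontr)
    assume "\<not> x \<preceq> y"
    then have "x \<ominus> y \<noteq> \<^bold>0" using c by (simp add: ominus_bot0_iff)
    then obtain P where P: "prime_ideal P" "x \<ominus> y \<notin> P" using prime_ideal_avoiding c by (meson ominus_closed)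
    then have id: "mv_ideal P" and "y \<ominus> x \<in> P" using c by (auto simp: prime_ideal_def)
    then have "multiple M k (y \<ominus> x) \<in> P" by (simp add: multiple_in_ideal)
    moreover have "x \<ominus> y \<preceq> multiple M k (y \<ominus> x)"
    proof -
      have "x \<ominus> y = (\<sim> a \<oplus> multiple M k y) \<ominus> (\<sim> a \<oplus> multiple M k x)"
        unfolding x y using c by (simp add: neg_ominus_neg)
      also have "\<dots> \<preceq> (\<sim> a \<ominus> \<sim> a) \<oplus> (multiple M k y \<ominus> multiple M k x)"
        using c \<open>a \<in> carrier M\<close> by (intro oplus_ominus_oplus) simp_all
      also have "\<dots> \<preceq> multiple M k (y \<ominus> x)"
        using c \<open>a \<in> carrier M\<close> by (simp add: multiple_ominus_multiple)
      finally show ?thesis using c \<open>a \<in> carrier M\<close> by simp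
    qed
    ultimately have "x \<ominus> y \<in> P" using mv_idealD(4)[OF id] c by simp
    then show False using P(2) by simp
  qed
  then show ?thesis using assms le_antisym by blast
qed

end

section \<open>Quotients by prime ideals\<close>

context mv_algebra
begin

definition ideal_eq :: "'a set \<Rightarrow> 'a \<Rightarrow> 'a \<Rightarrow> bool" where
  "ideal_eq P x y \<longleftrightarrow> x \<ominus> y \<in> P \<and> y \<ominus> x \<in> P"

text \<open>Congruent elements satisfy the same predicate and so get the same representative. The
  quotient thus remains on the type \<open>'a\<close>.\<close>

definition rep :: "'a set \<Rightarrow> 'a \<Rightarrow> 'a" where
  "rep P x = (SOME y. y \<in> carrier M \<and> ideal_eq P x y)"

definition quot :: "'a set \<Rightarrow> 'a mv" where
  "quot P = \<lparr>carrier = rep P ` carrier M, oplus = (\<lambda>x y. rep P (x \<oplus> y)),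
     neg = (\<lambda>x. rep P (\<sim> x)), bot0 = rep P \<^bold>0, top1 = rep P \<^bold>1\<rparr>"

end

text \<open>Nontriviality is part of the notion because Chang's group removes the top from the
  carrier and needs zero to remain.\<close>

locale mv_chain = mv_algebra +
  assumes le_total: "\<lbrakk>x \<in> carrier M; y \<in> carrier M\<rbrakk> \<Longrightarrow> x \<preceq> y \<or> y \<preceq> x"
    and bot0_neq_top1: "\<^bold>0 \<noteq> \<^bold>1"

context mv_algebra
begin

context
  fixes P assumes P: "mv_ideal P"
begin

lemma ideal_eq_refl: "x \<in> carrier M \<Longrightarrow> ideal_eq P x x"
  using mv_idealD(2)[OF P] by (simp add: ideal_eq_def)

lemma ideal_eq_sym: "ideal_eq P x y \<Longrightarrow> ideal_eq P y x"
  by (simp add: ideal_eq_def)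

lemma ideal_eq_trans:
  assumes "ideal_eq P x y" "ideal_eq P y z"
    and "x \<in> carrier M" "y \<in> carrier M" "z \<in> carrier M"
  shows "ideal_eq P x z"
proof -
  have "x \<ominus> z \<in> P"
    by (rule mv_idealD(4)[OF P _ _ ominus_triangle[of x y z]])
      (use assms mv_idealD(3)[OF P] in \<open>simp_all add: ideal_eq_def\<close>)
  moreover have "z \<ominus> x \<in> P"
    by (rule mv_idealD(4)[OF P _ _ ominus_triangle[of z y x]])
      (use assms mv_idealD(3)[OF P] in \<open>simp_all add: ideal_eq_def\<close>)
  ultimately show ?thesis by (simp add: ideal_eq_def)
qed

lemma ideal_eq_oplus:
  assumes "ideal_eq P x x'" "ideal_eq P y y'"
    and "x \<in> carrier M" "y \<in> carrier M" "x' \<in> carrier M" "y' \<in> carrier M"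
  shows "ideal_eq P (x \<oplus> y) (x' \<oplus> y')"
proof -
  have "x \<oplus> y \<ominus> (x' \<oplus> y') \<in> P"
    by (rule mv_idealD(4)[OF P _ _ oplus_ominus_oplus])
      (use assms mv_idealD(3)[OF P] in \<open>simp_all add: ideal_eq_def\<close>)
  moreover have "x' \<oplus> y' \<ominus> (x \<oplus> y) \<in> P"
    by (rule mv_idealD(4)[OF P _ _ oplus_ominus_oplus])
      (use assms mv_idealD(3)[OF P] in \<open>simp_all add: ideal_eq_def\<close>)
  ultimately show ?thesis by (simp add: ideal_eq_def)
qed

lemma ideal_eq_neg:
  "\<lbrakk>ideal_eq P x y; x \<in> carrier M; y \<in> carrier M\<rbrakk> \<Longrightarrow> ideal_eq P (\<sim> x) (\<sim> y)"
  by (simp add: ideal_eq_def neg_ominus_neg)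

lemma rep_props:
  assumes "x \<in> carrier M"
  shows "rep P x \<in> carrier M" "ideal_eq P x (rep P x)"
proof -
  have "rep P x \<in> carrier M \<and> ideal_eq P x (rep P x)"
    unfolding rep_def by (rule someI[of _ x]) (use assms ideal_eq_refl in blast)
  then show "rep P x \<in> carrier M" "ideal_eq P x (rep P x)" by auto
qed

lemma rep_eq_iff:
  assumes "x \<in> carrier M" "y \<in> carrier M"
  shows "rep P x = rep P y \<longleftrightarrow> ideal_eq P x y"
proof
  assume "rep P x = rep P y"
  then show "ideal_eq P x y"
    using rep_props assms ideal_eq_sym ideal_eq_trans by metis
next
  assume "ideal_eq P x y"
  then have "z \<in> carrier M \<and> ideal_eq P x z \<longleftrightarrow> z \<in> carrier M \<and> ideal_eq P y z" for z
    using assms ideal_eq_sym ideal_eq_trans by metis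
  then show "rep P x = rep P y" by (simp add: rep_def)
qed

lemma rep_oplus:
  assumes "x \<in> carrier M" "y \<in> carrier M"
  shows "rep P (rep P x \<oplus> rep P y) = rep P (x \<oplus> y)"
    and "rep P (rep P x \<oplus> y) = rep P (x \<oplus> y)" "rep P (x \<oplus> rep P y) = rep P (x \<oplus> y)"
  using assms rep_props ideal_eq_refl ideal_eq_sym by (simp_all add: rep_eq_iff ideal_eq_oplus)

lemma rep_neg: "x \<in> carrier M \<Longrightarrow> rep P (\<sim> rep P x) = rep P (\<sim> x)"
  and rep_rep: "x \<in> carrier M \<Longrightarrow> rep P (rep P x) = rep P x"
  using rep_props ideal_eq_sym by (simp_all add: rep_eq_iff ideal_eq_neg)

lemma rep_hom: "rep P \<in> mv_hom M (quot P)"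
  by (auto simp: mv_hom_def quot_def rep_oplus rep_neg)

lemma mv_algebra_quot: "mv_algebra (quot P)"
proof (rule mv_algebraI, goal_cases)
  case (4 x y)
  then show ?case by (auto simp: quot_def rep_oplus oplus_comm)
next
  case (10 x y)
  then obtain s t where "s \<in> carrier M" "t \<in> carrier M" "x = rep P s" "y = rep P t"
    by (auto simp: quot_def)
  then show ?case
    by (simp add: quot_def rep_oplus rep_neg rep_props(1) lukasiewicz)
qed (auto simp: quot_def rep_oplus rep_neg rep_rep rep_props(1) oplus_assoc)

lemma quot_le_iff:
  assumes "x \<in> carrier M" "y \<in> carrier M"
  shows "mv_algebra.le (quot P) (rep P x) (rep P y) \<longleftrightarrow> x \<ominus> y \<in> P"
proof -
  have "mv_algebra.le (quot P) (rep P x) (rep P y) \<longleftrightarrow> rep P (\<sim> x \<oplus> y) = rep P \<^bold>1"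
    unfolding mv_algebra.le_def[OF mv_algebra_quot]
    using assms by (simp add: quot_def rep_oplus rep_neg rep_props(1))
  also have "\<dots> \<longleftrightarrow> x \<ominus> y \<in> P"
    using assms mv_idealD(2)[OF P] by (simp add: rep_eq_iff ideal_eq_def ominus_def)
  finally show ?thesis .
qed

end

lemma mv_chain_quot:
  assumes P: "prime_ideal P"
  shows "mv_chain (quot P)"
proof -
  have id: "mv_ideal P" using P by (simp add: prime_ideal_def)
  interpret Q: mv_algebra "quot P" by (rule mv_algebra_quot[OF id])
  show ?thesis
  proof
    fix p q assume "p \<in> carrier (quot P)" "q \<in> carrier (quot P)"
    then obtain x y where "x \<in> carrier M" "y \<in> carrier M" "p = rep P x" "q = rep P y"
      by (auto simp: quot_def)
    then show "Q.le p q \<or> Q.le q p"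
      using P by (auto simp: quot_le_iff[OF id] prime_ideal_def)
  next
    have "rep P \<^bold>0 \<noteq> rep P \<^bold>1"
      using P by (simp add: rep_eq_iff[OF id] ideal_eq_def prime_ideal_def ominus_def)
    then show "bot0 (quot P) \<noteq> top1 (quot P)" by (simp add: quot_def)
  qed
qed

text \<open>The prime ideals meet in zero by \<open>prime_ideal_avoiding\<close>. This makes the map
  into the product of the quotients injective.\<close>

lemma eq_if_rep_eq:
  assumes "\<And>P. prime_ideal P \<Longrightarrow> rep P x = rep P y" and c: "x \<in> carrier M" "y \<in> carrier M"
  shows "x = y"
proof -
  have "x \<ominus> y \<in> P \<and> y \<ominus> x \<in> P" if "prime_ideal P" for P
    using assms(1)[OF that] that c by (simp add: rep_eq_iff prime_ideal_def ideal_eq_def)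
  then have "x \<ominus> y = \<^bold>0" "y \<ominus> x = \<^bold>0"
    using prime_ideal_avoiding c by (meson ominus_closed)+
  then show ?thesis using c by (simp add: ominus_bot0_iff le_antisym)
qed

end

section \<open>Unit intervals of totally ordered groups\<close>

locale ordered_comm_group = comm_group G for G (structure) +
  fixes gle :: "'a \<Rightarrow> 'a \<Rightarrow> bool" (infix "\<lesssim>" 50)
  assumes gle_total: "\<lbrakk>x \<in> carrier G; y \<in> carrier G\<rbrakk> \<Longrightarrow> x \<lesssim> y \<or> y \<lesssim> x"
    and gle_antisym: "\<lbrakk>x \<lesssim> y; y \<lesssim> x; x \<in> carrier G; y \<in> carrier G\<rbrakk> \<Longrightarrow> x = y"
    and gle_trans: "\<lbrakk>x \<lesssim> y; y \<lesssim> z; x \<in> carrier G; y \<in> carrier G; z \<in> carrier G\<rbrakk> \<Longrightarrow> x \<lesssim> z"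
    and gle_mult: "\<lbrakk>x \<lesssim> y; x \<in> carrier G; y \<in> carrier G; z \<in> carrier G\<rbrakk> \<Longrightarrow> x \<otimes> z \<lesssim> y \<otimes> z"
begin

lemma gle_refl [simp]: "x \<in> carrier G \<Longrightarrow> x \<lesssim> x"
  using gle_total by blast

lemma gle_mult_cancel:
  assumes "x \<in> carrier G" "y \<in> carrier G" "z \<in> carrier G"
  shows "x \<otimes> z \<lesssim> y \<otimes> z \<longleftrightarrow> x \<lesssim> y"
proof
  assume "x \<otimes> z \<lesssim> y \<otimes> z"
  from gle_mult[OF this, of "inv z"] show "x \<lesssim> y" using assms by (simp add: m_assoc)
qed (use assms gle_mult in blast)

lemma gle_mult_mono:
  assumes "x \<lesssim> x'" "y \<lesssim> y'" "x \<in> carrier G" "x' \<in> carrier G" "y \<in> carrier G" "y' \<in> carrier G"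
  shows "x \<otimes> y \<lesssim> x' \<otimes> y'"
proof -
  have "x \<otimes> y \<lesssim> x' \<otimes> y" using assms gle_mult by blast
  moreover have "x' \<otimes> y \<lesssim> x' \<otimes> y'" using gle_mult[of y y' x'] assms by (simp add: m_comm)
  ultimately show ?thesis using assms gle_trans by (meson m_closed)
qed

definition truncate :: "'a \<Rightarrow> 'a \<Rightarrow> 'a" where
  "truncate v x = (if x \<lesssim> v then x else v)"

text \<open>Mundici's \<open>\<Gamma>(G, v)\<close>, for a group written multiplicatively.\<close>

definition gamma :: "'a \<Rightarrow> 'a mv" where
  "gamma v = \<lparr>carrier = {x \<in> carrier G. \<one> \<lesssim> x \<and> x \<lesssim> v}, oplus = (\<lambda>x y. truncate v (x \<otimes> y)),
     neg = (\<lambda>x. v \<otimes> inv x), bot0 = \<one>, top1 = v\<rparr>"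

context
  fixes v assumes v: "v \<in> carrier G" "\<one> \<lesssim> v"
begin

lemma truncate_closed [simp]: "x \<in> carrier G \<Longrightarrow> truncate v x \<in> carrier G"
  using v by (simp add: truncate_def)

text \<open>If \<open>x\<close> exceeds \<open>v\<close>, a factor \<open>y\<close> above the unit
  cannot bring the product back below \<open>v\<close>. Associativity of \<open>gamma\<close> rests
  on this.\<close>

lemma truncate_mult_truncate:
  assumes "x \<in> carrier G" "y \<in> carrier G" "\<one> \<lesssim> y"
  shows "truncate v (truncate v x \<otimes> y) = truncate v (x \<otimes> y)"
proof (cases "x \<lesssim> v")
  case False
  then have vx: "v \<lesssim> x" using gle_total assms v by blast
  have "v \<lesssim> v \<otimes> y" using gle_mult_mono[OF gle_refl assms(3)] v assms by simp
  moreover have "v \<otimes> y \<lesssim> x \<otimes> y" using gle_mult[OF vx] v assms by simp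
  ultimately have "v \<lesssim> x \<otimes> y" using gle_trans v assms by (meson m_closed)
  then have "truncate v (v \<otimes> y) = v" "truncate v (x \<otimes> y) = v"
    using \<open>v \<lesssim> v \<otimes> y\<close> gle_antisym v assms by (auto simp: truncate_def)
  then show ?thesis using False by (simp add: truncate_def)
qed (simp add: truncate_def)

lemma mv_algebra_gamma: "mv_algebra (gamma v)"
proof (rule mv_algebraI, goal_cases)
  case (1 x y)
  then have "\<one> \<lesssim> x \<otimes> y" using gle_mult_mono[of \<one> x \<one> y] by (simp add: gamma_def)
  then show ?case using 1 v by (simp add: gamma_def truncate_def)
next
  case (3 x y z)
  then show ?case
    using truncate_mult_truncate[of "x \<otimes> y" z] truncate_mult_truncate[of "y \<otimes> z" x]
    by (simp add: gamma_def m_ac)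
next
  case (6 x)
  then show ?case
    using gle_mult_cancel[of \<one> "v \<otimes> inv x" x] gle_mult_cancel[of "v \<otimes> inv x" v x]
      gle_mult_mono[of v v \<one> x] v by (simp add: gamma_def m_assoc)
next
  case (8 x)
  then show ?case using v by (simp add: gamma_def inv_mult m_assoc[symmetric])
next
  case (9 x)
  then show ?case
    using gle_antisym[of "x \<otimes> v" v] gle_mult_mono[of \<one> x v v] v by (auto simp: gamma_def truncate_def)
next
  case (10 x y)
  \<comment> \<open>Each side of the axiom is a maximum. If \<open>x \<lesssim> y\<close>, the inner
    term is not cut and the group computation leaves \<open>y\<close>; otherwise it is cut to
    \<open>v\<close>, whose negation is the unit, leaving \<open>x\<close>.\<close>
  have lukasiewicz_max: "truncate v (x \<otimes> (v \<otimes> inv (truncate v (x \<otimes> (v \<otimes> inv y))))) = (if x \<lesssim> y then y else x)"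
    if "x \<in> carrier G" "y \<in> carrier G" "x \<lesssim> v" "y \<lesssim> v" for x y
  proof -
    have "x \<otimes> (v \<otimes> inv y) \<lesssim> v \<longleftrightarrow> x \<lesssim> y"
      using gle_mult_cancel[of x y "v \<otimes> inv y"] that v by (simp add: m_lcomm[of y])
    moreover have "x \<otimes> (v \<otimes> inv (x \<otimes> (v \<otimes> inv y))) = y"
    proof -
      have "x \<otimes> (v \<otimes> inv (x \<otimes> (v \<otimes> inv y))) = (x \<otimes> v) \<otimes> inv ((x \<otimes> v) \<otimes> inv y)"
        using that v by (simp add: m_assoc)
      also have "\<dots> = (x \<otimes> v) \<otimes> (inv (x \<otimes> v) \<otimes> y)"
        using that v inv_mult[of "x \<otimes> v" "inv y"] by simp
      also have "\<dots> = y"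
        using that v by (simp only: m_assoc[symmetric] m_closed inv_closed r_inv l_one)
      finally show ?thesis .
    qed
    ultimately show ?thesis using that v by (simp add: truncate_def)
  qed
  show ?case
    using lukasiewicz_max[of x y] lukasiewicz_max[of y x] 10 gle_total[of x y] gle_antisym[of x y]
    by (auto simp: gamma_def)
qed (use v in \<open>auto simp: gamma_def truncate_def m_comm\<close>)

end

end

text \<open>The second equation excludes truncated sums: in the real unit interval it says 1 - a +
  (n - 1)x = 1 - x, that is, a = nx.\<close>

definition is_division :: "'a mv \<Rightarrow> nat \<Rightarrow> 'a \<Rightarrow> 'a \<Rightarrow> bool" where
  "is_division M n a x \<longleftrightarrow> multiple M n x = a \<and> \<sim>\<^bsub>M\<^esub> a \<oplus>\<^bsub>M\<^esub> multiple M (n - 1) x = \<sim>\<^bsub>M\<^esub> x"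

section \<open>Scaling by \<open>n\<close>, from \<open>gamma u\<close> to
  \<open>gamma (u [^] n)\<close>\<close>

context ordered_comm_group
begin

lemma pow_mono:
  assumes "x \<lesssim> y" "x \<in> carrier G" "y \<in> carrier G"
  shows "x [^] (k::nat) \<lesssim> y [^] k"
proof (induction k)
  case (Suc k)
  then show ?case using assms gle_mult_mono[of "x [^] k" "y [^] k" x y] by simp
qed simp

text \<open>For the reflection of the order: if \<open>y \<lesssim> x\<close>, then replacing all
  but one factor \<open>x\<close> of \<open>x [^] n\<close> by \<open>y\<close> keeps the product
  below \<open>y [^] n\<close>, and cancelling \<open>y [^] k\<close> gives
  \<open>x \<lesssim> y\<close>.\<close>

lemma pow_le_pow_iff:
  assumes x: "x \<in> carrier G" and y: "y \<in> carrier G" and n: "n \<ge> (1::nat)"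
  shows "x [^] n \<lesssim> y [^] n \<longleftrightarrow> x \<lesssim> y"
proof
  assume le: "x [^] n \<lesssim> y [^] n"
  obtain k where k: "n = Suc k" using n by (cases n) auto
  show "x \<lesssim> y"
  proof (rule ccontr)
    assume "\<not> x \<lesssim> y"
    then have yx: "y \<lesssim> x" using gle_total x y by blast
    have "y [^] k \<otimes> x \<lesssim> x [^] k \<otimes> x" using gle_mult pow_mono[OF yx] x y by simp
    then have "y [^] k \<otimes> x \<lesssim> y [^] k \<otimes> y"
      using le gle_trans[of "y [^] k \<otimes> x" "x [^] k \<otimes> x" "y [^] k \<otimes> y"] x y k by simp
    then have "x \<lesssim> y" using gle_mult_cancel[of x y "y [^] k"] x y by (simp add: m_comm)
    then show False using \<open>\<not> x \<lesssim> y\<close> by simp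
  qed
qed (use assms pow_mono in blast)

lemma pow_eq_iff:
  "\<lbrakk>x \<in> carrier G; y \<in> carrier G; n \<ge> (1::nat)\<rbrakk> \<Longrightarrow> x [^] n = y [^] n \<longleftrightarrow> x = y"
  using pow_le_pow_iff[of x y n] pow_le_pow_iff[of y x n] gle_antisym[of x y] gle_refl
  by (metis nat_pow_closed)

lemma one_le_pow: "\<lbrakk>x \<in> carrier G; \<one> \<lesssim> x\<rbrakk> \<Longrightarrow> \<one> \<lesssim> x [^] (k::nat)"
  using pow_mono[of \<one> x k] by simp

lemma pow_le_pow:
  assumes x: "x \<in> carrier G" "\<one> \<lesssim> x" and "j \<le> k"
  shows "x [^] j \<lesssim> x [^] (k::nat)"
proof -
  have "\<one> \<otimes> x [^] j \<lesssim> x [^] (k - j) \<otimes> x [^] j"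
    using x one_le_pow by (intro gle_mult) simp_all
  then show ?thesis using x \<open>j \<le> k\<close> by (simp add: nat_pow_mult)
qed

context
  fixes u and n :: nat
  assumes u: "u \<in> carrier G" "\<one> \<lesssim> u" and n: "n \<ge> 1"
begin

lemma truncate_pow:
  "x \<in> carrier G \<Longrightarrow> truncate (u [^] n) (x [^] n) = (truncate u x) [^] n"
  using u n by (simp add: truncate_def pow_le_pow_iff)

text \<open>Powers are homomorphisms of the commutative group, and \<open>truncate_pow\<close> makes
  them commute with the cut.\<close>

lemma pow_hom_gamma: "(\<lambda>x. x [^] n) \<in> mv_hom (gamma u) (gamma (u [^] n))"
  using u one_le_pow pow_mono
  by (auto simp: mv_hom_def gamma_def truncate_pow nat_pow_distrib[symmetric] nat_pow_inv[symmetric])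

text \<open>Since \<open>x \<lesssim> u\<close>, up to \<open>n\<close> factors stay below the
  enlarged unit \<open>u [^] n\<close>, so nothing is cut.\<close>

lemma multiple_gamma_pow:
  assumes x: "x \<in> carrier (gamma u)" and "k \<le> n"
  shows "multiple (gamma (u [^] n)) k x = x [^] k"
  using \<open>k \<le> n\<close>
proof (induction k rule: induct_nat_012)
  case 0 then show ?case by (simp add: gamma_def)
next
  case 1 then show ?case using x by (simp add: gamma_def)
next
  case (ge2 k)
  have x': "x \<in> carrier G" "\<one> \<lesssim> x" "x \<lesssim> u" using x by (auto simp: gamma_def)
  have "x [^] Suc (Suc k) \<lesssim> x [^] n" using x' ge2.prems by (intro pow_le_pow) simp_all
  then have "x [^] Suc (Suc k) \<lesssim> u [^] n"
    using pow_mono[OF x'(3)] x' u gle_trans by (meson nat_pow_closed)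
  then show ?case using ge2 by (simp add: gamma_def truncate_def)
qed

lemma gamma_division:
  assumes x: "x \<in> carrier (gamma u)"
  shows "x \<in> carrier (gamma (u [^] n))"
    and "is_division (gamma (u [^] n)) n (x [^] n) x"
proof -
  have x': "x \<in> carrier G" "\<one> \<lesssim> x" "x \<lesssim> u" using x by (auto simp: gamma_def)
  have "u \<lesssim> u [^] n" using pow_le_pow[OF u, of 1 n] n u by simp
  then show xG: "x \<in> carrier (gamma (u [^] n))"
    using x' u gle_trans[of x u "u [^] n"] by (simp add: gamma_def)
  have k: "x [^] n = x [^] (n - 1) \<otimes> x" using n by (cases n) auto
  have eq: "u [^] n \<otimes> inv (x [^] n) \<otimes> x [^] (n - 1) = u [^] n \<otimes> inv x"
  proof -
    have "u [^] n \<otimes> inv (x [^] n) \<otimes> x [^] (n - 1) = u [^] n \<otimes> inv x \<otimes> (inv (x [^] (n - 1)) \<otimes> x [^] (n - 1))"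
      unfolding k using x' u by (simp add: inv_mult m_assoc m_lcomm)
    then show ?thesis using x' u by simp
  qed
  \<comment> \<open>The bound shows that the sum in the second division equation is not cut, so the
    group identity \<open>eq\<close> settles it.\<close>
  have "u [^] n \<otimes> inv x \<lesssim> u [^] n"
    using gle_mult_cancel[of "u [^] n \<otimes> inv x" "u [^] n" x] gle_mult_mono[of "u [^] n" "u [^] n" \<one> x] x' u
    by (simp add: m_assoc)
  then show "is_division (gamma (u [^] n)) n (x [^] n) x"
    using multiple_gamma_pow[OF x, of n] multiple_gamma_pow[OF x, of "n - 1"] eq
    by (simp add: is_division_def gamma_def truncate_def)
qed

end

end

section \<open>Chang's group of a chain\<close>

context mv_algebra
begin

text \<open>Write \<open>c\<close> as \<open>\<sim> b \<odot> (b \<oplus> c)\<close>; as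
  \<open>a\<close> and \<open>b\<close> do not overlap, the factor \<open>\<sim> b\<close> strips
  \<open>b\<close> off \<open>a \<oplus> b\<close>. The three swap lemmas are the cases of
  associativity in Chang's group.\<close>

lemma oplus_odot_swap0:
  assumes ab: "a \<odot> b = \<^bold>0" and bc: "b \<odot> c = \<^bold>0"
    and c: "a \<in> carrier M" "b \<in> carrier M" "c \<in> carrier M"
  shows "(a \<oplus> b) \<odot> c = a \<odot> (b \<oplus> c)"
proof -
  have c_eq: "c = \<sim> b \<odot> (b \<oplus> c)"
    using odot_residual_le[of c "\<sim> b"] bc c odot_bot0_iff[of c b] by (simp add: odot_comm)
  have a_eq: "(a \<oplus> b) \<odot> \<sim> b = a"
    using odot_residual_le[of a "\<sim> b"] ab c by (simp add: odot_bot0_iff odot_comm oplus_comm)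
  have "(a \<oplus> b) \<odot> c = ((a \<oplus> b) \<odot> \<sim> b) \<odot> (b \<oplus> c)"
    using c by (subst c_eq) (simp add: odot_assoc)
  then show ?thesis using a_eq by simp
qed

text \<open>The De Morgan dual of \<open>oplus_odot_swap0\<close>.\<close>

lemma oplus_odot_swap1:
  assumes ab: "a \<oplus> b = \<^bold>1" and bc: "b \<oplus> c = \<^bold>1"
    and c: "a \<in> carrier M" "b \<in> carrier M" "c \<in> carrier M"
  shows "(a \<odot> b) \<oplus> c = a \<oplus> (b \<odot> c)"
proof -
  have "(\<sim> a \<oplus> \<sim> b) \<odot> \<sim> c = \<sim> a \<odot> (\<sim> b \<oplus> \<sim> c)"
    by (rule oplus_odot_swap0) (use assms in \<open>simp_all add: odot_def\<close>)
  then have "\<sim> ((\<sim> a \<oplus> \<sim> b) \<odot> \<sim> c) = \<sim> (\<sim> a \<odot> (\<sim> b \<oplus> \<sim> c))" by simp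
  then show ?thesis using c by (simp add: odot_def)
qed

text \<open>Split \<open>b\<close> as \<open>?q \<oplus> ?r\<close>. By
  \<open>oplus_odot_swap0\<close>, \<open>a \<oplus> ?q\<close> is disjoint from
  \<open>\<sim> c\<close> for \<open>\<odot>\<close>, so it lies below \<open>c\<close>, and the
  left side is its meet with \<open>c\<close>.\<close>

lemma oplus_odot_swap01:
  assumes ab: "a \<odot> b = \<^bold>0" and bc: "b \<oplus> c = \<^bold>1"
    and c: "a \<in> carrier M" "b \<in> carrier M" "c \<in> carrier M"
  shows "(a \<oplus> b) \<odot> c = a \<oplus> (b \<odot> c)"
proof -
  let ?q = "b \<odot> c" and ?r = "\<sim> c"
  have rb: "?r \<preceq> b" using bc c by (simp add: le_def oplus_comm)
  have b_eq: "b = ?q \<oplus> ?r"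
    using lukasiewicz[of ?r b] rb c by (simp add: le_def odot_def oplus_comm)
  have qb: "?q \<preceq> b" using c by (simp add: odot_le1)
  have ab': "a \<preceq> \<sim> b" using ab c by (simp add: odot_bot0_iff)
  then have "a \<preceq> \<sim> ?q" using qb c le_trans[of a "\<sim> b" "\<sim> ?q"] by (simp add: neg_le_iff)
  then have aq: "a \<odot> ?q = \<^bold>0" using c by (simp add: odot_bot0_iff)
  have qr: "?q \<odot> ?r = \<^bold>0" using c by (simp add: odot_assoc)
  have "(a \<oplus> ?q) \<odot> ?r = \<^bold>0"
    using oplus_odot_swap0[OF aq qr] b_eq ab c by simp
  then have le: "a \<oplus> ?q \<preceq> c" using c by (simp add: odot_bot0_iff)
  have "(a \<oplus> b) \<odot> c = c \<odot> (\<sim> c \<oplus> (a \<oplus> ?q))"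
    using c by (subst b_eq) (simp add: oplus_ac odot_comm)
  also have "\<dots> = a \<oplus> ?q" using odot_residual_le[OF le] c by simp
  finally show ?thesis .
qed

text \<open>The pair \<open>(i, c)\<close> stands for \<open>i + c\<close>; excluding \<open>c = \<^bold>1\<close> makes the representation unique.\<close>

definition chang_group :: "(int \<times> 'a) monoid" where
  "chang_group = \<lparr>carrier = UNIV \<times> (carrier M - {\<^bold>1}),
     monoid.mult = (\<lambda>(i, c) (j, d). if c \<oplus> d = \<^bold>1 then (i + j + 1, c \<odot> d) else (i + j, c \<oplus> d)),
     one = (0, \<^bold>0)\<rparr>"

definition chang_le :: "int \<times> 'a \<Rightarrow> int \<times> 'a \<Rightarrow> bool" where
  "chang_le p q \<longleftrightarrow> fst p < fst q \<or> fst p = fst q \<and> snd p \<preceq> snd q"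

text \<open>The top becomes the integer one, since a pair with the top as second component is
  excluded.\<close>

definition chang_emb :: "'a \<Rightarrow> int \<times> 'a" where
  "chang_emb c = (if c = \<^bold>1 then (1, \<^bold>0) else (0, c))"

end

context mv_chain
begin

text \<open>By totality either \<open>\<sim> x \<preceq> y\<close>, so the sum reaches the top, or
  \<open>y \<preceq> \<sim> x\<close>, so the product vanishes.\<close>

lemma odot_bot0_if_oplus_neq_top1:
  assumes "x \<oplus> y \<noteq> \<^bold>1" "x \<in> carrier M" "y \<in> carrier M"
  shows "x \<odot> y = \<^bold>0"
  using assms le_total[of "\<sim> x" y] by (auto simp: odot_bot0_iff le_def oplus_comm)

lemma odot_neq_top1: "\<lbrakk>x \<noteq> \<^bold>1; x \<in> carrier M; y \<in> carrier M\<rbrakk> \<Longrightarrow> x \<odot> y \<noteq> \<^bold>1"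
  using odot_le1[of x y] top1_le_iff[of x] by auto

lemma comm_group_chang: "comm_group chang_group"
proof (rule comm_groupI, goal_cases)
  case (3 p q r)
  obtain i a j b k c where p: "p = (i, a)" "q = (j, b)" "r = (k, c)" by (cases p, cases q, cases r)
  then have c: "a \<in> carrier M" "b \<in> carrier M" "c \<in> carrier M" "a \<noteq> \<^bold>1" "b \<noteq> \<^bold>1" "c \<noteq> \<^bold>1"
    using 3 by (auto simp: chang_group_def)
  note z = odot_bot0_if_oplus_neq_top1
  \<comment> \<open>Associativity splits by which of the two neighbouring sums carries into the
    integer part.\<close>
  consider "a \<oplus> b = \<^bold>1" "b \<oplus> c = \<^bold>1" | "a \<oplus> b = \<^bold>1" "b \<oplus> c \<noteq> \<^bold>1"
    | "a \<oplus> b \<noteq> \<^bold>1" "b \<oplus> c = \<^bold>1" | "a \<oplus> b \<noteq> \<^bold>1" "b \<oplus> c \<noteq> \<^bold>1" by blast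
  then show ?case
  proof cases
    case 1
    then show ?thesis
      using oplus_odot_swap1[of a b c] c by (simp add: p chang_group_def odot_assoc)
  next
    case 2
    have s: "(a \<odot> b) \<oplus> c = a \<odot> (b \<oplus> c)"
      using oplus_odot_swap01[of c b a] 2 c z[of b c] by (simp add: odot_comm oplus_comm)
    moreover have "a \<odot> (b \<oplus> c) \<noteq> \<^bold>1" using c odot_neq_top1 by simp
    moreover have "a \<oplus> (b \<oplus> c) = \<^bold>1" using 2 c by (simp add: oplus_assoc[symmetric])
    ultimately show ?thesis using 2 c by (simp add: p chang_group_def)
  next
    case 3
    have s: "(a \<oplus> b) \<odot> c = a \<oplus> (b \<odot> c)"
      using oplus_odot_swap01[of a b c] 3 c z[of a b] by simp
    moreover have "(a \<oplus> b) \<odot> c \<noteq> \<^bold>1" using c odot_neq_top1[of c "a \<oplus> b"] by (simp add: odot_comm)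
    moreover have "a \<oplus> b \<oplus> c = \<^bold>1" using 3 c by (simp add: oplus_assoc)
    ultimately show ?thesis using 3 c by (simp add: p chang_group_def)
  next
    case 4
    then show ?thesis
      using oplus_odot_swap0[of a b c] c z[of a b] z[of b c]
      by (simp add: p chang_group_def oplus_assoc)
  qed
next
  case (6 p)
  obtain i c where p: "p = (i, c)" "c \<in> carrier M" "c \<noteq> \<^bold>1" using 6 by (auto simp: chang_group_def)
  show ?case
  \<comment> \<open>The inverse of \<open>(i, c)\<close> negates \<open>i\<close>. For nonzero
    \<open>c\<close> the sum of \<open>c\<close> and \<open>\<sim> c\<close> carries, hence the
    additional - 1.\<close>
  proof (cases "c = \<^bold>0")
    case True
    then show ?thesis using p bot0_neq_top1 by (intro bexI[of _ "(- i, \<^bold>0)"]) (auto simp: chang_group_def)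
  next
    case False
    then show ?thesis
      using p neg_eq_iff[of c "\<^bold>0"] by (intro bexI[of _ "(- i - 1, \<sim> c)"]) (auto simp: chang_group_def)
  qed
qed (use bot0_neq_top1 odot_neq_top1 in \<open>auto simp: chang_group_def oplus_comm odot_comm split: if_splits\<close>)

lemma ordered_comm_group_chang: "ordered_comm_group chang_group chang_le"
proof (rule ordered_comm_group.intro[OF comm_group_chang], unfold_locales, goal_cases)
  case (1 x y)
  then show ?case using le_total[of "snd x" "snd y"] by (auto simp: chang_le_def chang_group_def)
next
  case (2 x y)
  then show ?case using le_antisym[of "snd x" "snd y"] by (auto simp: chang_le_def chang_group_def)
next
  case (3 x y z)
  then show ?case using le_trans[of "snd x" "snd y" "snd z"] by (auto simp: chang_le_def chang_group_def)
next
  case (4 p q r)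
  obtain i a j b k c where p: "p = (i, a)" "q = (j, b)" "r = (k, c)" by (cases p, cases q, cases r)
  have c: "a \<in> carrier M" "b \<in> carrier M" "c \<in> carrier M"
    using 4 by (auto simp: p chang_group_def)
  \<comment> \<open>Needed when \<open>j = i + 1\<close> and only the left sum carries: the integer
    parts then tie and the second components decide.\<close>
  have "a \<odot> c \<preceq> b \<oplus> c"
    using c odot_le2[of a c] le_oplus2[of b c] le_trans by (meson odot_closed oplus_closed)
  moreover have "a \<oplus> c \<preceq> b \<oplus> c" "a \<odot> c \<preceq> b \<odot> c" if "a \<preceq> b"
    using that c by (simp_all add: oplus_mono odot_mono)
  moreover have "b \<oplus> c = \<^bold>1" if "a \<oplus> c = \<^bold>1" "a \<oplus> c \<preceq> b \<oplus> c"
    using that c by (simp add: top1_le_iff)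
  ultimately show ?case using 4(1) by (auto simp: p chang_group_def chang_le_def)
qed

interpretation chang: ordered_comm_group chang_group chang_le
  by (rule ordered_comm_group_chang)

lemma chang_unit: "(1, \<^bold>0) \<in> carrier chang_group" "chang_le \<one>\<^bsub>chang_group\<^esub> (1, \<^bold>0)"
  using bot0_neq_top1 by (auto simp: chang_group_def chang_le_def)

lemma inj_chang_emb: "inj_on chang_emb (carrier M)"
  by (auto simp: inj_on_def chang_emb_def)

lemma chang_emb_closed: "c \<in> carrier M \<Longrightarrow> chang_emb c \<in> carrier (chang.gamma (1, \<^bold>0))"
  unfolding chang.gamma_def
  using bot0_neq_top1 by (auto simp: chang_emb_def chang_group_def chang_le_def)

lemma chang_emb_neg:
  assumes "c \<in> carrier M"
  shows "chang_emb (\<sim> c) = (1, \<^bold>0) \<otimes>\<^bsub>chang_group\<^esub> inv\<^bsub>chang_group\<^esub> chang_emb c"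
proof -
  have cl: "chang_emb c \<in> carrier chang_group" "chang_emb (\<sim> c) \<in> carrier chang_group"
    using chang_emb_closed assms by (simp_all add: chang.gamma_def)
  have "chang_emb (\<sim> c) \<otimes>\<^bsub>chang_group\<^esub> chang_emb c = (1, \<^bold>0)"
    using assms bot0_neq_top1 neg_eq_iff[of c "\<^bold>0"] by (auto simp: chang_emb_def chang_group_def neg_eq_bot0_iff)
  then show ?thesis using cl chang.inv_solve_right chang_unit by metis
qed

text \<open>A sum that reaches the top has integer part at least one and is cut to the unit, the
  image of the top.\<close>

lemma chang_emb_oplus:
  assumes "c \<in> carrier M" "d \<in> carrier M"
  shows "chang_emb (c \<oplus> d) = chang.truncate (1, \<^bold>0) (chang_emb c \<otimes>\<^bsub>chang_group\<^esub> chang_emb d)"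
  unfolding chang.truncate_def
  using assms bot0_neq_top1
  by (auto simp: chang_emb_def chang_group_def chang_le_def le_bot0_iff)

lemma chang_emb_hom: "chang_emb \<in> mv_hom M (chang.gamma (1, \<^bold>0))"
  unfolding mv_hom_def using chang_emb_closed bot0_neq_top1
  by (auto simp: chang.gamma_def chang_emb_neg chang_emb_oplus)
    (auto simp: chang_emb_def chang_group_def)

lemma chain_division_extension:
  assumes n: "n \<ge> (1::nat)"
  shows "\<exists>(N :: (int \<times> 'a) mv) h. mv_algebra N \<and> h \<in> mv_hom M N \<and> inj_on h (carrier M) \<and>
     (\<forall>c\<in>carrier M. \<exists>x\<in>carrier N. is_division N n (h c) x)"
proof -
  let ?u = "(1, \<^bold>0)" let ?v = "?u [^]\<^bsub>chang_group\<^esub> n"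
  let ?h = "\<lambda>c. chang_emb c [^]\<^bsub>chang_group\<^esub> n"
  have "mv_algebra (chang.gamma ?v)"
    using chang.mv_algebra_gamma chang.one_le_pow[OF chang_unit] chang_unit by simp
  moreover have "?h \<in> mv_hom M (chang.gamma ?v)"
    using chang_emb_hom chang.pow_hom_gamma[OF chang_unit n] by (auto simp: mv_hom_def Pi_iff)
  moreover have "inj_on ?h (carrier M)"
    using inj_chang_emb chang_emb_closed chang.pow_eq_iff[OF _ _ n]
    by (simp add: inj_on_def chang.gamma_def)
  ultimately show ?thesis
    using chang.gamma_division[OF chang_unit n] chang_emb_closed by blast
qed

end

section \<open>Adjoining a part\<close>

lemma mv_homD:
  assumes "h \<in> mv_hom M N"
  shows "x \<in> carrier M \<Longrightarrow> h x \<in> carrier N"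
    and "\<lbrakk>x \<in> carrier M; y \<in> carrier M\<rbrakk> \<Longrightarrow> h (x \<oplus>\<^bsub>M\<^esub> y) = h x \<oplus>\<^bsub>N\<^esub> h y"
    and "x \<in> carrier M \<Longrightarrow> h (\<sim>\<^bsub>M\<^esub> x) = \<sim>\<^bsub>N\<^esub> h x"
    and "h \<^bold>0\<^bsub>M\<^esub> = \<^bold>0\<^bsub>N\<^esub>" "h \<^bold>1\<^bsub>M\<^esub> = \<^bold>1\<^bsub>N\<^esub>"
  using assms by (auto simp: mv_hom_def)

lemma mv_hom_multiple:
  assumes h: "h \<in> mv_hom M N" and "mv_algebra M" and x: "x \<in> carrier M"
  shows "h (multiple M k x) = multiple N k (h x)"
proof -
  interpret mv_algebra M by fact
  show ?thesis
  proof (induction k rule: induct_nat_012)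
    case (ge2 k)
    then show ?case using mv_homD(2)[OF h] multiple_closed[OF x] x by (simp del: multiple_Suc)
  qed (simp_all add: mv_homD(4)[OF h])
qed

lemma is_division_hom:
  assumes h: "h \<in> mv_hom M N" and M: "mv_algebra M" and c: "a \<in> carrier M" "x \<in> carrier M"
    and "is_division M n a x"
  shows "is_division N n (h a) (h x)"
proof -
  interpret mv_algebra M by fact
  have "h (\<sim>\<^bsub>M\<^esub> a \<oplus>\<^bsub>M\<^esub> multiple M (n - 1) x) = \<sim>\<^bsub>N\<^esub> h a \<oplus>\<^bsub>N\<^esub> multiple N (n - 1) (h x)"
    using c mv_homD(2,3)[OF h] mv_hom_multiple[OF h M c(2)] by simp
  then show ?thesis
    using assms(5) c mv_homD(3)[OF h, of x] mv_hom_multiple[OF h M c(2), of n] by (auto simp: is_division_def)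
qed

text \<open>Reflection along an embedding pulls the adjoined part back to the original
  algebra.\<close>

lemma is_division_hom_iff:
  assumes h: "h \<in> mv_hom M N" and inj: "inj_on h (carrier M)" and M: "mv_algebra M"
    and c: "a \<in> carrier M" "x \<in> carrier M"
  shows "is_division N n (h a) (h x) \<longleftrightarrow> is_division M n a x"
proof
  interpret mv_algebra M by fact
  assume div: "is_division N n (h a) (h x)"
  have "h (multiple M n x) = h a"
    using div by (simp add: is_division_def mv_hom_multiple[OF h M c(2)])
  moreover have "h (\<sim>\<^bsub>M\<^esub> a \<oplus>\<^bsub>M\<^esub> multiple M (n - 1) x) = h (\<sim>\<^bsub>M\<^esub> x)"
    using div c by (simp add: is_division_def mv_homD(2,3)[OF h] mv_hom_multiple[OF h M c(2)])
  ultimately show "is_division M n a x"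
    using c by (simp add: is_division_def inj_on_eq_iff[OF inj])
qed (rule is_division_hom[OF h M c])

section \<open>Products of MV-algebras and the division extension\<close>

definition mv_prod :: "'i set \<Rightarrow> ('i \<Rightarrow> 'a mv) \<Rightarrow> ('i \<Rightarrow> 'a) mv" where
  "mv_prod I A = \<lparr>carrier = (\<Pi>\<^sub>E i\<in>I. carrier (A i)), oplus = (\<lambda>f g. \<lambda>i\<in>I. f i \<oplus>\<^bsub>A i\<^esub> g i),
     neg = (\<lambda>f. \<lambda>i\<in>I. \<sim>\<^bsub>A i\<^esub> f i), bot0 = (\<lambda>i\<in>I. \<^bold>0\<^bsub>A i\<^esub>), top1 = (\<lambda>i\<in>I. \<^bold>1\<^bsub>A i\<^esub>)\<rparr>"

lemma mv_algebra_prod: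
  assumes "\<And>i. i \<in> I \<Longrightarrow> mv_algebra (A i)"
  shows "mv_algebra (mv_prod I A)"
proof -
  have mem: "f i \<in> carrier (A i)" if "f \<in> (\<Pi>\<^sub>E i\<in>I. carrier (A i))" "i \<in> I" for f i
    using PiE_mem[OF that] .
  have arb: "f i = undefined" if "f \<in> (\<Pi>\<^sub>E i\<in>I. carrier (A i))" "i \<notin> I" for f i
    using PiE_arb[OF that] .
  note ax = mv_algebra.mv_simps(1-4,6)[OF assms] mv_algebra.neg_closed[OF assms]
    mv_algebra.neg_bot0[OF assms] mv_algebra.neg_neg[OF assms] mv_algebra.oplus_top1[OF assms]
  show ?thesis
    by (rule mv_algebraI)
      (auto simp: mv_prod_def fun_eq_iff mem arb ax
        intro: mv_algebra.oplus_comm[OF assms] mv_algebra.lukasiewicz[OF assms])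
qed

lemma multiple_prod:
  assumes "f \<in> carrier (mv_prod I A)"
  shows "multiple (mv_prod I A) k f = (\<lambda>i\<in>I. multiple (A i) k (f i))"
proof (induction k rule: induct_nat_012)
  case 1 then show ?case using assms by (auto simp: mv_prod_def PiE_def extensional_restrict)
next
  case (ge2 k) then show ?case by (auto simp: mv_prod_def)
qed (simp add: mv_prod_def)

lemma is_division_prod:
  assumes "a \<in> carrier (mv_prod I A)" "x \<in> carrier (mv_prod I A)"
    and "\<And>i. i \<in> I \<Longrightarrow> is_division (A i) n (a i) (x i)"
  shows "is_division (mv_prod I A) n a x"
proof -
  have "(\<lambda>i\<in>I. multiple (A i) n (x i)) = (\<lambda>i\<in>I. a i)"
    using assms(3) by (auto simp: is_division_def)
  moreover have "(\<lambda>i\<in>I. a i) = a" using assms(1) by (auto simp: mv_prod_def PiE_def extensional_restrict)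
  ultimately show ?thesis
    using assms(3) unfolding is_division_def multiple_prod[OF assms(2)] by (auto simp: mv_prod_def)
qed

lemma mv_hom_prod:
  assumes "\<And>i. i \<in> I \<Longrightarrow> h i \<in> mv_hom M (A i)"
  shows "(\<lambda>x. \<lambda>i\<in>I. h i x) \<in> mv_hom M (mv_prod I A)"
  using mv_homD[OF assms] by (auto simp: mv_hom_def mv_prod_def intro!: restrict_ext)

lemma mv_hom_comp:
  "\<lbrakk>g \<in> mv_hom L M; h \<in> mv_hom M N\<rbrakk> \<Longrightarrow> (\<lambda>x. h (g x)) \<in> mv_hom L N"
  by (auto simp: mv_hom_def Pi_iff)

text \<open>Extend each quotient by a prime ideal as a chain and take the product of the extensions.
  The prime ideals separate points, and the part of \<open>h a\<close> is chosen coordinate by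
  coordinate.\<close>

lemma (in mv_algebra) division_extension:
  assumes n: "n \<ge> (1::nat)" and a: "a \<in> carrier M"
  shows "\<exists>(N :: ('a set \<Rightarrow> int \<times> 'a) mv) h. mv_algebra N \<and> h \<in> mv_hom M N \<and> inj_on h (carrier M) \<and>
    (\<exists>x\<in>carrier N. is_division N n (h a) x)"
proof -
  let ?I = "{P. prime_ideal P}"
  have id: "mv_ideal P" if "P \<in> ?I" for P using that by (simp add: prime_ideal_def)
  have "\<exists>(N :: (int \<times> 'a) mv) h. mv_algebra N \<and> h \<in> mv_hom (quot P) N \<and> inj_on h (carrier (quot P)) \<and>
     (\<forall>c\<in>carrier (quot P). \<exists>x\<in>carrier N. is_division N n (h c) x)" if "P \<in> ?I" for P
    using mv_chain.chain_division_extension[OF mv_chain_quot n, of P] that by simp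
  then obtain A :: "'a set \<Rightarrow> (int \<times> 'a) mv" and g where A: "\<And>P. P \<in> ?I \<Longrightarrow> mv_algebra (A P)"
    and g: "\<And>P. P \<in> ?I \<Longrightarrow> g P \<in> mv_hom (quot P) (A P)"
    and inj: "\<And>P. P \<in> ?I \<Longrightarrow> inj_on (g P) (carrier (quot P))"
    and div: "\<And>P c. P \<in> ?I \<Longrightarrow> c \<in> carrier (quot P) \<Longrightarrow> \<exists>x\<in>carrier (A P). is_division (A P) n (g P c) x"
    by metis
  have rep: "rep P x \<in> carrier (quot P)" if "x \<in> carrier M" for P x
    using that by (simp add: quot_def)
  define h where "h x = (\<lambda>P\<in>?I. g P (rep P x))" for x
  have h: "h \<in> mv_hom M (mv_prod ?I A)"
    unfolding h_def by (rule mv_hom_prod) (use mv_hom_comp rep_hom id g in blast)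
  have "inj_on h (carrier M)"
  proof (rule inj_onI)
    fix x y assume c: "x \<in> carrier M" "y \<in> carrier M" and eq: "h x = h y"
    have "rep P x = rep P y" if "prime_ideal P" for P
      using fun_cong[OF eq, of P] that inj[of P] rep c by (auto simp: h_def inj_on_def)
    then show "x = y" using eq_if_rep_eq c by blast
  qed
  moreover have "\<exists>x\<in>carrier (mv_prod ?I A). is_division (mv_prod ?I A) n (h a) x"
  proof -
    have "\<forall>P\<in>?I. \<exists>x. x \<in> carrier (A P) \<and> is_division (A P) n (g P (rep P a)) x"
      using div rep[OF a] by blast
    then obtain x where x: "\<And>P. P \<in> ?I \<Longrightarrow> x P \<in> carrier (A P) \<and> is_division (A P) n (g P (rep P a)) (x P)"
      using bchoice by meson
    have "restrict x ?I \<in> carrier (mv_prod ?I A)" using x by (simp add: mv_prod_def)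
    moreover from this have "is_division (mv_prod ?I A) n (h a) (restrict x ?I)"
      by (rule is_division_prod[rotated]) (use x mv_homD(1)[OF h a] in \<open>auto simp: h_def\<close>)
    ultimately show ?thesis by blast
  qed
  ultimately show ?thesis using h mv_algebra_prod[of ?I A] A by blast
qed

section \<open>Generated subalgebras\<close>

definition mv_gen :: "'a mv \<Rightarrow> 'a set \<Rightarrow> 'a set" where
  "mv_gen M S = \<Inter>{Y. mv_closed M Y \<and> S \<subseteq> Y}"

lemma mv_gen_closed:
  assumes "mv_algebra M" "S \<subseteq> carrier M"
  shows "mv_closed M (mv_gen M S)" "S \<subseteq> mv_gen M S"
proof -
  interpret mv_algebra M by fact
  have "mv_closed M (carrier M)" by (simp add: mv_closed_def)
  then have "mv_gen M S \<subseteq> carrier M" using assms(2) by (auto simp: mv_gen_def)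
  then show "mv_closed M (mv_gen M S)" unfolding mv_closed_def by (auto simp: mv_gen_def mv_closed_def)
qed (auto simp: mv_gen_def)

lemma mv_algebra_sub:
  assumes "mv_algebra M" "mv_closed M Y"
  shows "mv_algebra (M\<lparr>carrier := Y\<rparr>)"
proof -
  interpret mv_algebra M by fact
  have Y: "Y \<subseteq> carrier M" "\<And>x. x \<in> Y \<Longrightarrow> x \<in> carrier M" using assms(2) by (auto simp: mv_closed_def)
  show ?thesis
    by (rule mv_algebraI)
      (use assms(2) lukasiewicz in \<open>auto simp: mv_closed_def Y(2) oplus_assoc intro: oplus_comm\<close>)
qed

lemma multiple_sub: "multiple (M\<lparr>carrier := Y\<rparr>) k x = multiple M k x"
  by (induction k rule: induct_nat_012) simp_all

text \<open>The equalizer of two homomorphisms is a subalgebra, so it contains everything generated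
  by \<open>S\<close>.\<close>

lemma mv_hom_eq_on_gen:
  assumes \<alpha>: "\<alpha> \<in> mv_hom (M\<lparr>carrier := mv_gen M S\<rparr>) N" and \<beta>: "\<beta> \<in> mv_hom (M\<lparr>carrier := mv_gen M S\<rparr>) N"
    and M: "mv_algebra M" and S: "S \<subseteq> carrier M"
    and eq: "\<And>s. s \<in> S \<Longrightarrow> \<alpha> s = \<beta> s" and y: "y \<in> mv_gen M S"
  shows "\<alpha> y = \<beta> y"
proof -
  let ?E = "{y \<in> mv_gen M S. \<alpha> y = \<beta> y}"
  have "mv_closed M ?E"
    using mv_gen_closed(1)[OF M S] \<alpha> \<beta> by (auto simp: mv_closed_def mv_hom_def)
  then have "mv_gen M S \<subseteq> ?E" using mv_gen_closed(2)[OF M S] eq by (auto simp: mv_gen_def)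
  then show ?thesis using y by blast
qed

theorem theorem3p14:
  fixes M :: "'a mv"
  assumes "mv_algebra M" and "epicomplete M"
  shows "mv_divisible M"
proof -
  interpret mv_algebra M by fact
  have "\<exists>m\<in>carrier M. is_division M n a m" if a: "a \<in> carrier M" and n: "n \<ge> 1" for a n
  proof -
    obtain N :: "('a set \<Rightarrow> int \<times> 'a) mv" and h x
      where N: "mv_algebra N" and h: "h \<in> mv_hom M N" and inj: "inj_on h (carrier M)"
        and x: "x \<in> carrier N" "is_division N n (h a) x"
      using division_extension[OF n a] by blast
    define S where "S = insert x (h ` carrier M)"
    define B where "B = N\<lparr>carrier := mv_gen N S\<rparr>"
    have S: "S \<subseteq> carrier N" using x(1) mv_homD(1)[OF h] by (auto simp: S_def)
    note gen = mv_gen_closed[OF N S]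
    have B: "mv_algebra B" unfolding B_def by (rule mv_algebra_sub[OF N gen(1)])
    have xB: "x \<in> carrier B" and hB: "h ` carrier M \<subseteq> carrier B"
      using gen(2) by (auto simp: B_def S_def)
    have h': "h \<in> mv_hom M B" using h hB by (auto simp: mv_hom_def B_def)
    have divB: "is_division B n (h a) x"
      using x(2) by (simp add: is_division_def B_def multiple_sub)
    have "mv_epi M B h"
      unfolding mv_epi_def
    proof (intro conjI allI impI ballI h')
      fix L :: "(('a set \<Rightarrow> int \<times> 'a) + nat) mv" and \<alpha> \<beta> y
      assume L: "mv_algebra L" and \<alpha>: "\<alpha> \<in> mv_hom B L" and \<beta>: "\<beta> \<in> mv_hom B L"
        and eq: "\<forall>x\<in>carrier M. \<alpha> (h x) = \<beta> (h x)" and y: "y \<in> carrier B"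
      have ha: "h a \<in> carrier B" using hB a by blast
      \<comment> \<open>Both images of \<open>x\<close> divide the same element, because
        \<open>\<alpha>\<close> and \<open>\<beta>\<close> agree at \<open>h a\<close>. Uniqueness
        of parts then makes them agree on all generators of \<open>B\<close>.\<close>
      have "is_division L n (\<alpha> (h a)) (\<alpha> x)" "is_division L n (\<alpha> (h a)) (\<beta> x)"
        using is_division_hom[OF \<alpha> B ha xB divB] is_division_hom[OF \<beta> B ha xB divB] eq a by simp_all
      then have "\<alpha> x = \<beta> x"
        using mv_algebra.division_unique[OF L, of "\<alpha> (h a)" "\<alpha> x" "\<beta> x" "n - 1"]
          mv_homD(1)[OF \<alpha>] mv_homD(1)[OF \<beta>] ha xB by (simp add: is_division_def)
      then show "\<alpha> y = \<beta> y"
        using mv_hom_eq_on_gen[OF \<alpha>[unfolded B_def] \<beta>[unfolded B_def] N S, of y] eq y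
        by (auto simp: S_def B_def)
    qed
    \<comment> \<open>\<open>B\<close> does not live on \<open>'a + nat\<close>, so the
      type-independent form of epicompleteness is used.\<close>
    then have "h ` carrier M = carrier B" using epicomplete_surj[OF assms B] by blast
    then obtain m where m: "m \<in> carrier M" "x = h m" using xB by blast
    then show ?thesis using x(2) is_division_hom_iff[OF h inj assms(1) a m(1)] by auto
  qed
  then show ?thesis by (simp add: mv_divisible_def is_division_def)
qed

end
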